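(* Let $\mathcal{K}$ be a finitely complete Kan enriched category and let $\Phi$ be a product closed filter on the poset $\mathrm{Sub}(1)$ of subobjects of the final object $1$ of $\mathcal{K}$. Let $\mathcal{K}_\Phi$ have the same objects as $\mathcal{K}$, mapping simplicial sets $$\mathrm{Map}_{\mathcal{K}_\Phi}(X,Y)=\mathrm{colim}\big(\mathrm{Map}_{\mathcal{K}}(-\times X,Y):\Phi^{op}\to \mathcal{K}\mathrm{an}\big),$$ and, for $k$-simplices $[f]\in \mathrm{Map}_{\mathcal{K}_\Phi}(X,Y)_k$, $[g]\in \mathrm{Map}_{\mathcal{K}_\Phi}(Y,Z)_k$ represented by $f\in\mathrm{Map}_{\mathcal K}(X\times U,Y)_k$ and $g\in \mathrm{Map}_{\mathcal K}(Y\times V,Z)_k$ with $U,V\in\Phi$, composition $[g]\circ[f]=[g(f\times \mathrm{id}_V)]$. Then $\mathcal{K}_\Phi$ is a Kan enriched category.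
   Context: A Kan enriched category is a simplicially enriched category all of whose mapping simplicial sets are Kan complexes; $\mathcal{K}\mathrm{an}$ is the category of Kan complexes. $\mathrm{Sub}(1)$ is the poset of subobjects of the final object $1$, which has finite meets given by the product $U\times V\to 1$. A product closed filter $\Phi\subseteq \mathrm{Sub}(1)$ is a subset that contains $1$, is closed under finite products and is upward closed. $\Phi$ is regarded as a full subcategory of $\mathcal{K}$ via the canonical functor $\mathcal{I}:\Phi\hookrightarrow\mathcal{K}$, and $-\times-:\mathcal{K}\times\mathcal{K}\to\mathcal{K}$ is the product functor. For $X,Y$ in $\mathcal{K}$ the functor $\Phi^{op}\to\mathcal{K}\mathrm{an}$ is $U\mapsto \mathrm{Map}_{\mathcal{K}}(X\times U,Y)$; the (strict) colimit is taken in simplicial sets, hence level-wise, over the filtered category $\Phi^{op}$. Identities are the classes of the identity morphisms $X\times 1\cong X\to X$. In the composition formula, $f\times\mathrm{id}_V$ is a $k$-simplex of $\mathrm{Map}_{\mathcal K}(X\times U\times V,Y\times V)$, so $g(f\times \mathrm{id}_V)$ is a $k$-simplex of $\mathrm{Map}_{\mathcal K}(X\times (U\times V),Z)$ with $U\times V\in\Phi$. *)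

theory Defs
  imports Main "HOL-Library.FuncSet"
begin

section \<open>Simplicial sets\<close>

text \<open>The arrows [m] \<rightarrow> [n] of the simplex category, as extensional functions, so that two arrows
  are equal as HOL functions iff they agree on {0,...,m}.  Composites are formed with
  \<^term>\<open>compose\<close>.\<close>

definition simplex_arr :: "nat \<Rightarrow> nat \<Rightarrow> (nat \<Rightarrow> nat) set" where
  "simplex_arr m n = {\<alpha> \<in> {..m} \<rightarrow>\<^sub>E {..n}. mono_on {..m} \<alpha>}"

text \<open>For \<open>\<alpha> \<in> simplex_arr m n\<close>, \<open>act X m n \<alpha>\<close> is the structure map from n-simplices to m-simplices.\<close>

record 'a sset =
  Spx :: "nat \<Rightarrow> 'a set"
  act :: "nat \<Rightarrow> nat \<Rightarrow> (nat \<Rightarrow> nat) \<Rightarrow> 'a \<Rightarrow> 'a"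

definition simplicial_set :: "'a sset \<Rightarrow> bool" where
  "simplicial_set X \<longleftrightarrow>
     (\<forall>m n. \<forall>\<alpha>\<in>simplex_arr m n. \<forall>x\<in>Spx X n. act X m n \<alpha> x \<in> Spx X m) \<and>
     (\<forall>n. \<forall>x\<in>Spx X n. act X n n (\<lambda>i\<in>{..n}. i) x = x) \<and>
     (\<forall>l m n. \<forall>\<beta>\<in>simplex_arr l m. \<forall>\<alpha>\<in>simplex_arr m n. \<forall>x\<in>Spx X n.
        act X l m \<beta> (act X m n \<alpha> x) = act X l n (compose {..l} \<alpha> \<beta>) x)"

definition simplicial_map :: "'a sset \<Rightarrow> 'b sset \<Rightarrow> (nat \<Rightarrow> 'a \<Rightarrow> 'b) \<Rightarrow> bool" where
  "simplicial_map X Y \<phi> \<longleftrightarrow>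
     (\<forall>n. \<forall>x\<in>Spx X n. \<phi> n x \<in> Spx Y n) \<and>
     (\<forall>m n. \<forall>\<alpha>\<in>simplex_arr m n. \<forall>x\<in>Spx X n. \<phi> m (act X m n \<alpha> x) = act Y m n \<alpha> (\<phi> n x))"

definition sset_prod :: "'a sset \<Rightarrow> 'b sset \<Rightarrow> ('a \<times> 'b) sset" where
  "sset_prod X Y = \<lparr> Spx = (\<lambda>n. Spx X n \<times> Spx Y n),
                     act = (\<lambda>m n \<alpha> (x, y). (act X m n \<alpha> x, act Y m n \<alpha> y)) \<rparr>"

definition std_simplex :: "nat \<Rightarrow> (nat \<Rightarrow> nat) sset" where
  "std_simplex n = \<lparr> Spx = (\<lambda>m. simplex_arr m n), act = (\<lambda>l m \<beta> \<alpha>. compose {..l} \<alpha> \<beta>) \<rparr>"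

definition horn :: "nat \<Rightarrow> nat \<Rightarrow> (nat \<Rightarrow> nat) sset" where
  "horn n k = \<lparr> Spx = (\<lambda>m. {\<alpha> \<in> simplex_arr m n. insert k (\<alpha> ` {..m}) \<noteq> {..n}}),
                act = (\<lambda>l m \<beta> \<alpha>. compose {..l} \<alpha> \<beta>) \<rparr>"

definition kan_complex :: "'a sset \<Rightarrow> bool" where
  "kan_complex X \<longleftrightarrow> simplicial_set X \<and>
     (\<forall>n\<ge>1. \<forall>k\<le>n. \<forall>\<phi>. simplicial_map (horn n k) X \<phi> \<longrightarrow>
        (\<exists>\<psi>. simplicial_map (std_simplex n) X \<psi> \<and>
             (\<forall>m. \<forall>\<alpha>\<in>Spx (horn n k) m. \<psi> m \<alpha> = \<phi> m \<alpha>)))"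


section \<open>Ordinary categories\<close>

text \<open>\<open>cComp C X Y Z g f\<close> is the composite of f from X to Y with g from Y to Z.\<close>

record ('j, 'h) cat =
  cOb :: "'j set"
  cHom :: "'j \<Rightarrow> 'j \<Rightarrow> 'h set"
  cId :: "'j \<Rightarrow> 'h"
  cComp :: "'j \<Rightarrow> 'j \<Rightarrow> 'j \<Rightarrow> 'h \<Rightarrow> 'h \<Rightarrow> 'h"

definition category :: "('j, 'h) cat \<Rightarrow> bool" where
  "category C \<longleftrightarrow>
     (\<forall>X\<in>cOb C. cId C X \<in> cHom C X X) \<and>
     (\<forall>X\<in>cOb C. \<forall>Y\<in>cOb C. \<forall>Z\<in>cOb C. \<forall>f\<in>cHom C X Y. \<forall>g\<in>cHom C Y Z.
        cComp C X Y Z g f \<in> cHom C X Z) \<and>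
     (\<forall>X\<in>cOb C. \<forall>Y\<in>cOb C. \<forall>f\<in>cHom C X Y.
        cComp C X X Y f (cId C X) = f \<and> cComp C X Y Y (cId C Y) f = f) \<and>
     (\<forall>W\<in>cOb C. \<forall>X\<in>cOb C. \<forall>Y\<in>cOb C. \<forall>Z\<in>cOb C.
        \<forall>f\<in>cHom C W X. \<forall>g\<in>cHom C X Y. \<forall>h\<in>cHom C Y Z.
        cComp C W X Z (cComp C X Y Z h g) f = cComp C W Y Z h (cComp C W X Y g f))"

definition finite_category :: "('j, 'h) cat \<Rightarrow> bool" where
  "finite_category C \<longleftrightarrow> category C \<and> finite (cOb C) \<and>
     (\<forall>X\<in>cOb C. \<forall>Y\<in>cOb C. finite (cHom C X Y))"

definition is_functor ::
  "('i, 'g) cat \<Rightarrow> ('j, 'h) cat \<Rightarrow> ('i \<Rightarrow> 'j) \<Rightarrow> ('i \<Rightarrow> 'i \<Rightarrow> 'g \<Rightarrow> 'h) \<Rightarrow> bool" where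
  "is_functor C D Fo Fm \<longleftrightarrow>
     (\<forall>X\<in>cOb C. Fo X \<in> cOb D) \<and>
     (\<forall>X\<in>cOb C. \<forall>Y\<in>cOb C. \<forall>f\<in>cHom C X Y. Fm X Y f \<in> cHom D (Fo X) (Fo Y)) \<and>
     (\<forall>X\<in>cOb C. Fm X X (cId C X) = cId D (Fo X)) \<and>
     (\<forall>X\<in>cOb C. \<forall>Y\<in>cOb C. \<forall>Z\<in>cOb C. \<forall>f\<in>cHom C X Y. \<forall>g\<in>cHom C Y Z.
        Fm X Z (cComp C X Y Z g f) = cComp D (Fo X) (Fo Y) (Fo Z) (Fm Y Z g) (Fm X Y f))"

definition op_cat :: "('j, 'h) cat \<Rightarrow> ('j, 'h) cat" where
  "op_cat C = \<lparr> cOb = cOb C, cHom = (\<lambda>X Y. cHom C Y X), cId = cId C,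
                cComp = (\<lambda>X Y Z g f. cComp C Z Y X f g) \<rparr>"

definition full_subcat :: "('j, 'h) cat \<Rightarrow> 'j set \<Rightarrow> ('j, 'h) cat" where
  "full_subcat C S = C \<lparr> cOb := cOb C \<inter> S \<rparr>"

definition is_iso :: "('j, 'h) cat \<Rightarrow> 'j \<Rightarrow> 'j \<Rightarrow> 'h \<Rightarrow> bool" where
  "is_iso C X Y f \<longleftrightarrow> f \<in> cHom C X Y \<and>
     (\<exists>g\<in>cHom C Y X. cComp C X Y X g f = cId C X \<and> cComp C Y X Y f g = cId C Y)"

definition is_mono :: "('j, 'h) cat \<Rightarrow> 'j \<Rightarrow> 'j \<Rightarrow> 'h \<Rightarrow> bool" where
  "is_mono C X Y m \<longleftrightarrow> m \<in> cHom C X Y \<and>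
     (\<forall>Z\<in>cOb C. \<forall>f\<in>cHom C Z X. \<forall>g\<in>cHom C Z X.
        cComp C Z X Y m f = cComp C Z X Y m g \<longrightarrow> f = g)"

text \<open>Subobjects of X are the isomorphism classes over X of monomorphisms (U, m) into X.\<close>

definition monos_into :: "('j, 'h) cat \<Rightarrow> 'j \<Rightarrow> ('j \<times> 'h) set" where
  "monos_into C X = {(U, m). U \<in> cOb C \<and> is_mono C U X m}"

definition mono_iso :: "('j, 'h) cat \<Rightarrow> 'j \<Rightarrow> (('j \<times> 'h) \<times> ('j \<times> 'h)) set" where
  "mono_iso C X = {((U, m), (V, n)). (U, m) \<in> monos_into C X \<and> (V, n) \<in> monos_into C X \<and>
     (\<exists>h. is_iso C U V h \<and> cComp C U V X n h = m)}"

definition Sub :: "('j, 'h) cat \<Rightarrow> 'j \<Rightarrow> ('j \<times> 'h) set set" where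
  "Sub C X = monos_into C X // mono_iso C X"

definition sub_class :: "('j, 'h) cat \<Rightarrow> 'j \<Rightarrow> 'j \<Rightarrow> 'h \<Rightarrow> ('j \<times> 'h) set" where
  "sub_class C X U m = mono_iso C X `` {(U, m)}"

definition sub_le :: "('j, 'h) cat \<Rightarrow> 'j \<Rightarrow> ('j \<times> 'h) set \<Rightarrow> ('j \<times> 'h) set \<Rightarrow> bool" where
  "sub_le C X S T \<longleftrightarrow>
     (\<exists>(U, m)\<in>S. \<exists>(V, n)\<in>T. \<exists>h\<in>cHom C U V. cComp C U V X n h = m)"


section \<open>Colimits of simplicial sets\<close>

text \<open>The colimit of F from C to simplicial sets, formed level-wise: the n-simplices are the quotient
  of the disjoint union of the sets of n-simplices of the \<open>F i\<close> by the equivalence relation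
  generated by identifying (i, x) with (j, F(h)(x)) for h from i to j.\<close>

definition colim_gen ::
  "('j, 'h) cat \<Rightarrow> ('j \<Rightarrow> 'a sset) \<Rightarrow> ('j \<Rightarrow> 'j \<Rightarrow> 'h \<Rightarrow> nat \<Rightarrow> 'a \<Rightarrow> 'a) \<Rightarrow> nat \<Rightarrow>
    'j \<times> 'a \<Rightarrow> 'j \<times> 'a \<Rightarrow> bool" where
  "colim_gen C Fo Fm n p q \<longleftrightarrow>
     (\<exists>i\<in>cOb C. \<exists>j\<in>cOb C. \<exists>h\<in>cHom C i j. \<exists>x\<in>Spx (Fo i) n. p = (i, x) \<and> q = (j, Fm i j h n x))"

definition colim_rel ::
  "('j, 'h) cat \<Rightarrow> ('j \<Rightarrow> 'a sset) \<Rightarrow> ('j \<Rightarrow> 'j \<Rightarrow> 'h \<Rightarrow> nat \<Rightarrow> 'a \<Rightarrow> 'a) \<Rightarrow> nat \<Rightarrow>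
    (('j \<times> 'a) \<times> ('j \<times> 'a)) set" where
  "colim_rel C Fo Fm n = {(p, q). equivclp (colim_gen C Fo Fm n) p q}"

definition sset_colim ::
  "('j, 'h) cat \<Rightarrow> ('j \<Rightarrow> 'a sset) \<Rightarrow> ('j \<Rightarrow> 'j \<Rightarrow> 'h \<Rightarrow> nat \<Rightarrow> 'a \<Rightarrow> 'a) \<Rightarrow> ('j \<times> 'a) set sset" where
  "sset_colim C Fo Fm =
     \<lparr> Spx = (\<lambda>n. (SIGMA i:cOb C. Spx (Fo i) n) // colim_rel C Fo Fm n),
       act = (\<lambda>m n \<alpha> c. colim_rel C Fo Fm m `` ((\<lambda>(i, x). (i, act (Fo i) m n \<alpha> x)) ` c)) \<rparr>"


section \<open>Simplicially enriched categories\<close>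

text \<open>\<open>Comp K n X Y Z g f\<close> is the composite of the n-simplices f of \<open>Map K X Y\<close> and g of
  \<open>Map K Y Z\<close>.\<close>

record ('o, 'a) scat =
  Obj :: "'o set"
  Map :: "'o \<Rightarrow> 'o \<Rightarrow> 'a sset"
  Comp :: "nat \<Rightarrow> 'o \<Rightarrow> 'o \<Rightarrow> 'o \<Rightarrow> 'a \<Rightarrow> 'a \<Rightarrow> 'a"
  Ident :: "'o \<Rightarrow> 'a"

text \<open>The totally degenerate n-simplex on a 0-simplex s of \<open>Map K X Y\<close>; this is how morphisms of the
  underlying category act on simplices of arbitrary dimension.\<close>

definition const_spx :: "('o, 'a) scat \<Rightarrow> nat \<Rightarrow> 'o \<Rightarrow> 'o \<Rightarrow> 'a \<Rightarrow> 'a" where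
  "const_spx K n X Y s = act (Map K X Y) n 0 (\<lambda>i\<in>{..n}. 0) s"

definition simplicial_category :: "('o, 'a) scat \<Rightarrow> bool" where
  "simplicial_category K \<longleftrightarrow>
     (\<forall>X\<in>Obj K. \<forall>Y\<in>Obj K. simplicial_set (Map K X Y)) \<and>
     (\<forall>X\<in>Obj K. \<forall>Y\<in>Obj K. \<forall>Z\<in>Obj K.
        simplicial_map (sset_prod (Map K Y Z) (Map K X Y)) (Map K X Z)
          (\<lambda>n (g, f). Comp K n X Y Z g f)) \<and>
     (\<forall>X\<in>Obj K. Ident K X \<in> Spx (Map K X X) 0) \<and>
     (\<forall>X\<in>Obj K. \<forall>Y\<in>Obj K. \<forall>n. \<forall>f\<in>Spx (Map K X Y) n.
        Comp K n X X Y f (const_spx K n X X (Ident K X)) = f \<and>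
        Comp K n X Y Y (const_spx K n Y Y (Ident K Y)) f = f) \<and>
     (\<forall>W\<in>Obj K. \<forall>X\<in>Obj K. \<forall>Y\<in>Obj K. \<forall>Z\<in>Obj K. \<forall>n.
        \<forall>f\<in>Spx (Map K W X) n. \<forall>g\<in>Spx (Map K X Y) n. \<forall>h\<in>Spx (Map K Y Z) n.
        Comp K n W X Z (Comp K n X Y Z h g) f = Comp K n W Y Z h (Comp K n W X Y g f))"

definition kan_enriched_category :: "('o, 'a) scat \<Rightarrow> bool" where
  "kan_enriched_category K \<longleftrightarrow> simplicial_category K \<and>
     (\<forall>X\<in>Obj K. \<forall>Y\<in>Obj K. kan_complex (Map K X Y))"

definition underlying_cat :: "('o, 'a) scat \<Rightarrow> ('o, 'a) cat" where
  "underlying_cat K = \<lparr> cOb = Obj K, cHom = (\<lambda>X Y. Spx (Map K X Y) 0), cId = Ident K,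
                        cComp = Comp K 0 \<rparr>"


section \<open>Finite limits in simplicially enriched categories\<close>

text \<open>Enriched (conical) limits: composition with the cone (L, p) identifies \<open>Map K Z L\<close> with the
  limit of the simplicial sets \<open>Map K Z (Do j)\<close>, i.e. there is a bijection in every simplicial
  degree n.  For n = 0 this is the limit property in the underlying category.\<close>

definition is_slimit ::
  "('o, 'a) scat \<Rightarrow> ('j, 'h) cat \<Rightarrow> ('j \<Rightarrow> 'o) \<Rightarrow> ('j \<Rightarrow> 'j \<Rightarrow> 'h \<Rightarrow> 'a) \<Rightarrow> 'o \<Rightarrow> ('j \<Rightarrow> 'a) \<Rightarrow> bool" where
  "is_slimit K J Do Dm L p \<longleftrightarrow> L \<in> Obj K \<and>
     (\<forall>j\<in>cOb J. p j \<in> Spx (Map K L (Do j)) 0) \<and>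
     (\<forall>i\<in>cOb J. \<forall>j\<in>cOb J. \<forall>h\<in>cHom J i j. Comp K 0 L (Do i) (Do j) (Dm i j h) (p i) = p j) \<and>
     (\<forall>Z\<in>Obj K. \<forall>n x.
        (\<forall>j\<in>cOb J. x j \<in> Spx (Map K Z (Do j)) n) \<and>
        (\<forall>i\<in>cOb J. \<forall>j\<in>cOb J. \<forall>h\<in>cHom J i j.
           Comp K n Z (Do i) (Do j) (const_spx K n (Do i) (Do j) (Dm i j h)) (x i) = x j) \<longrightarrow>
        (\<exists>!t. t \<in> Spx (Map K Z L) n \<and>
           (\<forall>j\<in>cOb J. Comp K n Z L (Do j) (const_spx K n L (Do j) (p j)) t = x j)))"

text \<open>Every finite category is isomorphic to one whose objects and arrows are natural numbers.\<close>

definition finitely_complete :: "('o, 'a) scat \<Rightarrow> bool" where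
  "finitely_complete K \<longleftrightarrow>
     (\<forall>(J :: (nat, nat) cat) Do Dm.
        finite_category J \<and> is_functor J (underlying_cat K) Do Dm \<longrightarrow>
        (\<exists>L p. is_slimit K J Do Dm L p))"

text \<open>A choice of final object and of binary products, which the product functor and the notation
  \<open>X \<times> U\<close> presuppose.\<close>

record ('o, 'a) fin_products =
  one :: 'o
  prd :: "'o \<Rightarrow> 'o \<Rightarrow> 'o"
  pr1 :: "'o \<Rightarrow> 'o \<Rightarrow> 'a"
  pr2 :: "'o \<Rightarrow> 'o \<Rightarrow> 'a"

definition is_sterminal :: "('o, 'a) scat \<Rightarrow> 'o \<Rightarrow> bool" where
  "is_sterminal K T \<longleftrightarrow> T \<in> Obj K \<and> (\<forall>Z\<in>Obj K. \<forall>n. \<exists>!t. t \<in> Spx (Map K Z T) n)"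

definition is_sproduct :: "('o, 'a) scat \<Rightarrow> 'o \<Rightarrow> 'o \<Rightarrow> 'o \<Rightarrow> 'a \<Rightarrow> 'a \<Rightarrow> bool" where
  "is_sproduct K X Y Q p q \<longleftrightarrow> Q \<in> Obj K \<and>
     p \<in> Spx (Map K Q X) 0 \<and> q \<in> Spx (Map K Q Y) 0 \<and>
     (\<forall>Z\<in>Obj K. \<forall>n. \<forall>f\<in>Spx (Map K Z X) n. \<forall>g\<in>Spx (Map K Z Y) n.
        \<exists>!t. t \<in> Spx (Map K Z Q) n \<and>
             Comp K n Z Q X (const_spx K n Q X p) t = f \<and>
             Comp K n Z Q Y (const_spx K n Q Y q) t = g)"

definition are_fin_products :: "('o, 'a) scat \<Rightarrow> ('o, 'a) fin_products \<Rightarrow> bool" where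
  "are_fin_products K P \<longleftrightarrow> is_sterminal K (one P) \<and>
     (\<forall>X\<in>Obj K. \<forall>Y\<in>Obj K. is_sproduct K X Y (prd P X Y) (pr1 P X Y) (pr2 P X Y))"

definition pairing ::
  "('o, 'a) scat \<Rightarrow> ('o, 'a) fin_products \<Rightarrow> nat \<Rightarrow> 'o \<Rightarrow> 'o \<Rightarrow> 'o \<Rightarrow> 'a \<Rightarrow> 'a \<Rightarrow> 'a" where
  "pairing K P n Z X Y f g =
     (THE t. t \<in> Spx (Map K Z (prd P X Y)) n \<and>
        Comp K n Z (prd P X Y) X (const_spx K n (prd P X Y) X (pr1 P X Y)) t = f \<and>
        Comp K n Z (prd P X Y) Y (const_spx K n (prd P X Y) Y (pr2 P X Y)) t = g)"

text \<open>The product functor on n-simplices f of \<open>Map K A B\<close> and g of \<open>Map K C D\<close>.\<close>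

definition prod_spx ::
  "('o, 'a) scat \<Rightarrow> ('o, 'a) fin_products \<Rightarrow> nat \<Rightarrow> 'o \<Rightarrow> 'o \<Rightarrow> 'o \<Rightarrow> 'o \<Rightarrow> 'a \<Rightarrow> 'a \<Rightarrow> 'a" where
  "prod_spx K P n A B C D f g =
     pairing K P n (prd P A C) B D
       (Comp K n (prd P A C) A B f (const_spx K n (prd P A C) A (pr1 P A C)))
       (Comp K n (prd P A C) C D g (const_spx K n (prd P A C) C (pr2 P A C)))"

text \<open>The canonical isomorphism \<open>X \<times> (U \<times> V) \<rightarrow> (X \<times> U) \<times> V\<close>.\<close>

definition prod_assoc ::
  "('o, 'a) scat \<Rightarrow> ('o, 'a) fin_products \<Rightarrow> 'o \<Rightarrow> 'o \<Rightarrow> 'o \<Rightarrow> 'a" where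
  "prod_assoc K P X U V =
     (let W = prd P U V; Q = prd P X W in
      pairing K P 0 Q (prd P X U) V
        (pairing K P 0 Q X U (pr1 P X W) (Comp K 0 Q W U (pr1 P U V) (pr2 P X W)))
        (Comp K 0 Q W V (pr2 P U V) (pr2 P X W)))"


section \<open>Product closed filters and the filter quotient\<close>

definition product_closed_filter ::
  "('o, 'a) scat \<Rightarrow> ('o, 'a) fin_products \<Rightarrow> ('o \<times> 'a) set set \<Rightarrow> bool" where
  "product_closed_filter K P \<Phi> \<longleftrightarrow>
     (let C = underlying_cat K in
      \<Phi> \<subseteq> Sub C (one P) \<and>
      sub_class C (one P) (one P) (Ident K (one P)) \<in> \<Phi> \<and>
      (\<forall>S\<in>\<Phi>. \<forall>T\<in>\<Phi>. \<forall>(U, m)\<in>S. \<forall>(V, n)\<in>T.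
         sub_class C (one P) (prd P U V) (Comp K 0 (prd P U V) U (one P) m (pr1 P U V)) \<in> \<Phi>) \<and>
      (\<forall>S\<in>\<Phi>. \<forall>T\<in>Sub C (one P). sub_le C (one P) S T \<longrightarrow> T \<in> \<Phi>))"

text \<open>\<open>\<Phi>\<close> as a full subcategory of the underlying category of K: the objects U for which the
  subobject represented by U \<open>\<rightarrow>\<close> 1 lies in \<open>\<Phi>\<close>.  All representatives are kept, so that
  U \<open>\<times>\<close> V is again an object; this category is equivalent to the poset \<open>\<Phi>\<close>.\<close>

definition filter_cat :: "('o, 'a) scat \<Rightarrow> ('o \<times> 'a) set set \<Rightarrow> ('o, 'a) cat" where
  "filter_cat K \<Phi> = full_subcat (underlying_cat K) (fst ` \<Union>\<Phi>)"

text \<open>The functor \<open>U \<mapsto> Map K (X \<times> U) Y\<close> on the opposite of \<open>filter_cat K \<Phi>\<close>.  An arrow from U to U' in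
  the opposite category is h from U' to U in K, and it acts by precomposition with \<open>id\<^sub>X \<times> h\<close>.\<close>

definition filter_diag_ob ::
  "('o, 'a) scat \<Rightarrow> ('o, 'a) fin_products \<Rightarrow> 'o \<Rightarrow> 'o \<Rightarrow> 'o \<Rightarrow> 'a sset" where
  "filter_diag_ob K P X Y U = Map K (prd P X U) Y"

definition filter_diag_mor ::
  "('o, 'a) scat \<Rightarrow> ('o, 'a) fin_products \<Rightarrow> 'o \<Rightarrow> 'o \<Rightarrow> 'o \<Rightarrow> 'o \<Rightarrow> 'a \<Rightarrow> nat \<Rightarrow> 'a \<Rightarrow> 'a" where
  "filter_diag_mor K P X Y U U' h n f =
     Comp K n (prd P X U') (prd P X U) Y f
       (const_spx K n (prd P X U') (prd P X U) (prod_spx K P 0 X X U' U (Ident K X) h))"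

definition filter_rel ::
  "('o, 'a) scat \<Rightarrow> ('o, 'a) fin_products \<Rightarrow> ('o \<times> 'a) set set \<Rightarrow> nat \<Rightarrow> 'o \<Rightarrow> 'o \<Rightarrow>
    (('o \<times> 'a) \<times> ('o \<times> 'a)) set" where
  "filter_rel K P \<Phi> n X Y =
     colim_rel (op_cat (filter_cat K \<Phi>)) (filter_diag_ob K P X Y) (filter_diag_mor K P X Y) n"

text \<open>The n-simplex \<open>g (f \<times> id\<^sub>V)\<close> of \<open>Map K (X \<times> (U \<times> V)) Z\<close>, for f in \<open>Map K (X \<times> U) Y\<close> and g in
  \<open>Map K (Y \<times> V) Z\<close>.\<close>

definition filter_comp_rep ::
  "('o, 'a) scat \<Rightarrow> ('o, 'a) fin_products \<Rightarrow> nat \<Rightarrow> 'o \<Rightarrow> 'o \<Rightarrow> 'o \<Rightarrow> 'o \<Rightarrow> 'o \<Rightarrow> 'a \<Rightarrow> 'a \<Rightarrow> 'a" where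
  "filter_comp_rep K P n X Y Z U V g f =
     (let Q = prd P X (prd P U V); Q' = prd P (prd P X U) V in
      Comp K n Q (prd P Y V) Z g
        (Comp K n Q Q' (prd P Y V)
          (prod_spx K P n (prd P X U) Y V V f (const_spx K n V V (Ident K V)))
          (const_spx K n Q Q' (prod_assoc K P X U V))))"

text \<open>Composition takes the union of the classes obtained from all representatives.  This union is a
  single class only if the composition formula does not depend on the representatives, so
  well-definedness is part of \<open>kan_enriched_category (filter_quotient K P \<Phi>)\<close>; see the lemma below.\<close>

definition filter_quotient ::
  "('o, 'a) scat \<Rightarrow> ('o, 'a) fin_products \<Rightarrow> ('o \<times> 'a) set set \<Rightarrow> ('o, ('o \<times> 'a) set) scat" where
  "filter_quotient K P \<Phi> =
     \<lparr> Obj = Obj K,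
       Map = (\<lambda>X Y. sset_colim (op_cat (filter_cat K \<Phi>))
                      (filter_diag_ob K P X Y) (filter_diag_mor K P X Y)),
       Comp = (\<lambda>n X Y Z G F. filter_rel K P \<Phi> n X Z ``
                 {(prd P U V, filter_comp_rep K P n X Y Z U V g f) | U V f g.
                    (U, f) \<in> F \<and> (V, g) \<in> G}),
       Ident = (\<lambda>X. filter_rel K P \<Phi> 0 X X `` {(one P, pr1 P X (one P))}) \<rparr>"

lemma filter_quotient_comp_formula:
  assumes kan: "kan_enriched_category (filter_quotient K P \<Phi>)"
    and XYZ: "X \<in> Obj K" "Y \<in> Obj K" "Z \<in> Obj K"
    and U: "U \<in> cOb (filter_cat K \<Phi>)" and f: "f \<in> Spx (Map K (prd P X U) Y) n"
    and V: "V \<in> cOb (filter_cat K \<Phi>)" and g: "g \<in> Spx (Map K (prd P Y V) Z) n"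
  shows "Comp (filter_quotient K P \<Phi>) n X Y Z
           (filter_rel K P \<Phi> n Y Z `` {(V, g)}) (filter_rel K P \<Phi> n X Y `` {(U, f)}) =
         filter_rel K P \<Phi> n X Z `` {(prd P U V, filter_comp_rep K P n X Y Z U V g f)}"
proof -
  let ?R = "filter_rel K P \<Phi> n X Z"
  let ?F = "filter_rel K P \<Phi> n X Y `` {(U, f)}" and ?G = "filter_rel K P \<Phi> n Y Z `` {(V, g)}"
  let ?c = "Comp (filter_quotient K P \<Phi>) n X Y Z ?G ?F"
  let ?s = "(prd P U V, filter_comp_rep K P n X Y Z U V g f)"
  have equiv: "equiv UNIV (filter_rel K P \<Phi> n X' Y')" for X' Y'
    unfolding filter_rel_def colim_rel_def
    by (intro equivI refl_onI symI transI)
      (auto intro: equivclp_sym equivclp_trans)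
  have mem: "?F \<in> Spx (Map (filter_quotient K P \<Phi>) X Y) n"
    "?G \<in> Spx (Map (filter_quotient K P \<Phi>) Y Z) n"
    using U V f g unfolding filter_quotient_def sset_colim_def
    by (auto simp: filter_rel_def filter_diag_ob_def op_cat_def intro!: quotientI)
  have "simplicial_map (sset_prod (Map (filter_quotient K P \<Phi>) Y Z) (Map (filter_quotient K P \<Phi>) X Y))
      (Map (filter_quotient K P \<Phi>) X Z) (\<lambda>n (g, f). Comp (filter_quotient K P \<Phi>) n X Y Z g f)"
    using kan XYZ unfolding kan_enriched_category_def simplicial_category_def
    by (simp add: filter_quotient_def)
  with mem have "?c \<in> Spx (Map (filter_quotient K P \<Phi>) X Z) n"
    by (force simp: simplicial_map_def sset_prod_def)
  then obtain a where a: "?c = ?R `` {a}"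
    by (auto simp: filter_quotient_def sset_colim_def filter_rel_def elim!: quotientE)
  have "(U, f) \<in> ?F" "(V, g) \<in> ?G"
    by (rule equiv_class_self[OF equiv], simp)+
  then have "?s \<in> ?c"
    using equiv_class_self[OF equiv] by (fastforce simp: filter_quotient_def)
  then show ?thesis
    using a equiv_class_eq[OF equiv] by fastforce
qed

end

theory Submission
  imports Defs
begin

text \<open>At each simplicial level, K is an ordinary category with finite products, and the simplicial
  operators preserve composition and pairing.  All identities between representatives in \<open>K\<^sub>\<Phi>\<close>
  (independence of the representatives, units, associativity) therefore reduce to identities between
  composites of projections and pairings, up to restriction along an arrow of \<open>\<Phi>\<close>.

  Since \<open>\<Phi>\<close> is closed under products, its opposite is filtered.  A horn has finitely many simplices
  in each dimension and is generated by those of dimension n, so a horn in a filtered colimit lifts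
  to one stage of the diagram, where it can be filled.\<close>

section \<open>Simplicial sets\<close>

text \<open>Composition in the quotient is a union over all pairs of representatives, so each axiom
  about it has to wait for \<open>Comp_cls\<close>, which shows that this union is one class. After
  that the only discrepancies are between index objects: 1 x U against U, or U x (V x T) against (U
  x V) x T. The canonical maps between them are arrows of the index category, along which classes do
  not change. The obstacle in the Kan condition is that a horn has simplices in every dimension,
  whereas passing to a later stage of a filtered diagram enforces only finitely many equations at a
  time. Faces of the horn are therefore not handled as simplices of lower dimension. The face
  spanned by a subset S of [n] is encoded by a monotone idempotent of [n] with image S, which is
  itself a (possibly degenerate) n-simplex of the horn. The data to be lifted become a finite set
  acted on by the finite monoid of endomorphisms of [n], and the equations to be enforced say that
  the lift is equivariant.\<close>

lemma simplex_arr_compose: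
  assumes "\<beta> \<in> simplex_arr l m" "\<alpha> \<in> simplex_arr m n"
  shows "compose {..l} \<alpha> \<beta> \<in> simplex_arr l n"
proof -
  have "\<beta> \<in> {..l} \<rightarrow> {..m}" "mono_on {..l} \<beta>" "\<alpha> \<in> {..m} \<rightarrow> {..n}" "mono_on {..m} \<alpha>"
    using assms by (auto simp: simplex_arr_def PiE_def)
  moreover from this have "mono_on {..l} (compose {..l} \<alpha> \<beta>)"
    by (auto simp: mono_on_def compose_def Pi_iff)
  ultimately show ?thesis
    by (auto simp: simplex_arr_def PiE_def Pi_iff compose_eq extensional_def compose_def)
qed

lemma simplex_arr_id: "(\<lambda>i\<in>{..n}. i) \<in> simplex_arr n n"
  by (auto simp: simplex_arr_def mono_on_def)

lemma simplex_arr_zero: "(\<lambda>i\<in>{..n}. 0) \<in> simplex_arr n 0"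
  by (auto simp: simplex_arr_def mono_on_def)

lemma simplex_arr_in: "\<alpha> \<in> simplex_arr m n \<Longrightarrow> i \<le> m \<Longrightarrow> \<alpha> i \<le> n"
  by (auto simp: simplex_arr_def PiE_def Pi_iff)

lemma compose_simplex_arr_zero:
  "\<alpha> \<in> simplex_arr m n \<Longrightarrow> compose {..m} (\<lambda>i\<in>{..n}. 0) \<alpha> = (\<lambda>i\<in>{..m}. 0)"
  by (auto simp: compose_def fun_eq_iff simplex_arr_in)

lemma finite_simplex_arr: "finite (simplex_arr m n)"
  unfolding simplex_arr_def by (rule finite_subset[of _ "{..m} \<rightarrow>\<^sub>E {..n}"]) (auto intro: finite_PiE)

lemma simplicial_set_act_in:
  "simplicial_set X \<Longrightarrow> \<alpha> \<in> simplex_arr m n \<Longrightarrow> x \<in> Spx X n \<Longrightarrow> act X m n \<alpha> x \<in> Spx X m"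
  unfolding simplicial_set_def by blast

lemma simplicial_set_act_id:
  "simplicial_set X \<Longrightarrow> x \<in> Spx X n \<Longrightarrow> act X n n (\<lambda>i\<in>{..n}. i) x = x"
  unfolding simplicial_set_def by blast

lemma simplicial_set_act_act:
  "simplicial_set X \<Longrightarrow> \<beta> \<in> simplex_arr l m \<Longrightarrow> \<alpha> \<in> simplex_arr m n \<Longrightarrow> x \<in> Spx X n \<Longrightarrow>
    act X l m \<beta> (act X m n \<alpha> x) = act X l n (compose {..l} \<alpha> \<beta>) x"
  unfolding simplicial_set_def by blast

lemma simplicial_map_in: "simplicial_map X Y \<phi> \<Longrightarrow> x \<in> Spx X n \<Longrightarrow> \<phi> n x \<in> Spx Y n"
  unfolding simplicial_map_def by blast

lemma simplicial_map_act:
  "simplicial_map X Y \<phi> \<Longrightarrow> \<alpha> \<in> simplex_arr m n \<Longrightarrow> x \<in> Spx X n \<Longrightarrow>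
    \<phi> m (act X m n \<alpha> x) = act Y m n \<alpha> (\<phi> n x)"
  unfolding simplicial_map_def by blast

text \<open>An idempotent of [n] with image S, rounding down to S. Inserting \<open>Min S\<close>
  keeps the set under \<open>Max\<close> nonempty and supplies the value at arguments below all of
  S.\<close>

definition simplex_retraction :: "nat \<Rightarrow> nat set \<Rightarrow> nat \<Rightarrow> nat" where
  "simplex_retraction n S = (\<lambda>x\<in>{..n}. Max (insert (Min S) {s \<in> S. s \<le> x}))"

lemma simplex_retraction:
  assumes "S \<subseteq> {..n}" "S \<noteq> {}"
  shows simplex_retraction_arr: "simplex_retraction n S \<in> simplex_arr n n"
    and simplex_retraction_image: "simplex_retraction n S ` {..n} = S"
    and simplex_retraction_fixes: "s \<in> S \<Longrightarrow> simplex_retraction n S s = s"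
proof -
  have fin: "finite S" using assms finite_subset by blast
  then have minS: "Min S \<in> S" using assms by simp
  have into: "simplex_retraction n S x \<in> S" if "x \<le> n" for x
  proof -
    have "Max (insert (Min S) {s \<in> S. s \<le> x}) \<in> insert (Min S) {s \<in> S. s \<le> x}"
      using fin by (intro Max_in) auto
    then show ?thesis using minS that by (auto simp: simplex_retraction_def)
  qed
  show fixed: "simplex_retraction n S s = s" if "s \<in> S" for s
  proof -
    have "Max (insert (Min S) {t \<in> S. t \<le> s}) = s"
      using fin that by (intro Max_eqI) auto
    moreover have "s \<le> n" using that assms by auto
    ultimately show ?thesis by (simp add: simplex_retraction_def)
  qed
  show "simplex_retraction n S ` {..n} = S"
  proof
    show "simplex_retraction n S ` {..n} \<subseteq> S" using into by auto
    show "S \<subseteq> simplex_retraction n S ` {..n}"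
    proof
      fix s assume "s \<in> S"
      with assms fixed[of s] show "s \<in> simplex_retraction n S ` {..n}" by (metis image_eqI subsetD)
    qed
  qed
  have "mono_on {..n} (simplex_retraction n S)"
    unfolding mono_on_def
    by (auto simp: simplex_retraction_def simp del: Max_insert intro!: Max_mono fin)
  then show "simplex_retraction n S \<in> simplex_arr n n"
    using into assms by (auto simp: simplex_arr_def PiE_def simplex_retraction_def)
qed

text \<open>S may be larger than the image of \<open>\<alpha>\<close>. This slack is what later
  compares the retraction chosen for a simplex with the one chosen for its restriction along an
  operator.\<close>

lemma compose_simplex_retraction:
  assumes "\<alpha> \<in> simplex_arr m n" "\<alpha> ` {..m} \<subseteq> S" "S \<subseteq> {..n}"
  shows "compose {..m} (simplex_retraction n S) \<alpha> = \<alpha>"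
proof
  fix i
  have "\<alpha> i \<in> S" if "i \<le> m" using assms(2) that by auto
  moreover have "S \<noteq> {}" using assms(2) by auto
  ultimately show "compose {..m} (simplex_retraction n S) \<alpha> i = \<alpha> i"
    using assms(1) simplex_retraction_fixes[OF assms(3)]
    by (auto simp: compose_def simplex_arr_def PiE_def extensional_def)
qed

section \<open>Filtered colimits of Kan complexes\<close>

definition filtered_category :: "('j, 'h) cat \<Rightarrow> bool" where
  "filtered_category C \<longleftrightarrow> category C \<and> cOb C \<noteq> {} \<and>
     (\<forall>i\<in>cOb C. \<forall>j\<in>cOb C. \<exists>k\<in>cOb C. cHom C i k \<noteq> {} \<and> cHom C j k \<noteq> {}) \<and>
     (\<forall>i\<in>cOb C. \<forall>j\<in>cOb C. \<forall>f\<in>cHom C i j. \<forall>g\<in>cHom C i j.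
        \<exists>k\<in>cOb C. \<exists>h\<in>cHom C j k. cComp C i j k h f = cComp C i j k h g)"

locale filtered_sset_diagram =
  fixes C :: "('j, 'h) cat" and Fo :: "'j \<Rightarrow> 'a sset"
    and Fm :: "'j \<Rightarrow> 'j \<Rightarrow> 'h \<Rightarrow> nat \<Rightarrow> 'a \<Rightarrow> 'a"
  assumes filtered: "filtered_category C"
    and Fo_sset: "i \<in> cOb C \<Longrightarrow> simplicial_set (Fo i)"
    and Fm_map: "i \<in> cOb C \<Longrightarrow> j \<in> cOb C \<Longrightarrow> h \<in> cHom C i j \<Longrightarrow>
      simplicial_map (Fo i) (Fo j) (Fm i j h)"
    and Fm_id: "i \<in> cOb C \<Longrightarrow> x \<in> Spx (Fo i) n \<Longrightarrow> Fm i i (cId C i) n x = x"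
    and Fm_comp: "i \<in> cOb C \<Longrightarrow> j \<in> cOb C \<Longrightarrow> k \<in> cOb C \<Longrightarrow> h \<in> cHom C i j \<Longrightarrow> h' \<in> cHom C j k \<Longrightarrow>
      x \<in> Spx (Fo i) n \<Longrightarrow> Fm i k (cComp C i j k h' h) n x = Fm j k h' n (Fm i j h n x)"
begin

abbreviation rel :: "nat \<Rightarrow> (('j \<times> 'a) \<times> ('j \<times> 'a)) set" where
  "rel \<equiv> colim_rel C Fo Fm"

abbreviation colim :: "('j \<times> 'a) set sset" where
  "colim \<equiv> sset_colim C Fo Fm"

lemma hom_id: "i \<in> cOb C \<Longrightarrow> cId C i \<in> cHom C i i"
  using filtered by (simp add: filtered_category_def category_def)

lemma hom_comp:
  "i \<in> cOb C \<Longrightarrow> j \<in> cOb C \<Longrightarrow> k \<in> cOb C \<Longrightarrow> h \<in> cHom C i j \<Longrightarrow> h' \<in> cHom C j k \<Longrightarrow>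
    cComp C i j k h' h \<in> cHom C i k"
  using filtered by (simp add: filtered_category_def category_def)

lemma join_objects:
  assumes "i \<in> cOb C" "j \<in> cOb C"
  obtains k h h' where "k \<in> cOb C" "h \<in> cHom C i k" "h' \<in> cHom C j k"
proof -
  have "\<exists>k\<in>cOb C. cHom C i k \<noteq> {} \<and> cHom C j k \<noteq> {}"
    using filtered assms by (simp add: filtered_category_def)
  then show ?thesis using that by blast
qed

lemma coequalize_arrows:
  assumes "i \<in> cOb C" "j \<in> cOb C" "f \<in> cHom C i j" "g \<in> cHom C i j"
  obtains k h where "k \<in> cOb C" "h \<in> cHom C j k" "cComp C i j k h f = cComp C i j k h g"
proof -
  have "\<exists>k\<in>cOb C. \<exists>h\<in>cHom C j k. cComp C i j k h f = cComp C i j k h g"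
    using filtered assms by (simp add: filtered_category_def)
  then show ?thesis using that by blast
qed

lemma Fm_in:
  "i \<in> cOb C \<Longrightarrow> j \<in> cOb C \<Longrightarrow> h \<in> cHom C i j \<Longrightarrow> x \<in> Spx (Fo i) n \<Longrightarrow> Fm i j h n x \<in> Spx (Fo j) n"
  by (rule simplicial_map_in[OF Fm_map])

section \<open>Identification of representatives in a filtered colimit\<close>

lemma equiv_rel: "equiv UNIV (rel n)"
  unfolding colim_rel_def
  by (intro equivI refl_onI symI transI) (auto intro: equivclp_sym equivclp_trans)

lemma rel_sym: "(p, q) \<in> rel n \<Longrightarrow> (q, p) \<in> rel n"
  unfolding colim_rel_def by (auto intro: equivclp_sym)

lemma rel_trans: "(p, q) \<in> rel n \<Longrightarrow> (q, r) \<in> rel n \<Longrightarrow> (p, r) \<in> rel n"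
  unfolding colim_rel_def by (auto intro: equivclp_trans)

lemma rel_Fm:
  "i \<in> cOb C \<Longrightarrow> j \<in> cOb C \<Longrightarrow> h \<in> cHom C i j \<Longrightarrow> x \<in> Spx (Fo i) n \<Longrightarrow>
    ((i, x), (j, Fm i j h n x)) \<in> rel n"
  unfolding colim_rel_def by (auto intro!: r_into_equivclp simp: colim_gen_def)

text \<open>The usual one-step description of equality in a filtered colimit: agreement at some
  common later stage. Membership of both representatives is built in, since \<open>rel\<close> is an
  equivalence relation on all pairs, including those that represent nothing.\<close>

definition meets :: "nat \<Rightarrow> 'j \<times> 'a \<Rightarrow> 'j \<times> 'a \<Rightarrow> bool" where
  "meets n p q \<longleftrightarrow> (\<exists>i\<in>cOb C. \<exists>j\<in>cOb C. \<exists>k\<in>cOb C. \<exists>x\<in>Spx (Fo i) n. \<exists>y\<in>Spx (Fo j) n.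
     \<exists>h\<in>cHom C i k. \<exists>h'\<in>cHom C j k. p = (i, x) \<and> q = (j, y) \<and> Fm i k h n x = Fm j k h' n y)"

lemma meetsI:
  "i \<in> cOb C \<Longrightarrow> j \<in> cOb C \<Longrightarrow> k \<in> cOb C \<Longrightarrow> x \<in> Spx (Fo i) n \<Longrightarrow> y \<in> Spx (Fo j) n \<Longrightarrow>
    h \<in> cHom C i k \<Longrightarrow> h' \<in> cHom C j k \<Longrightarrow> Fm i k h n x = Fm j k h' n y \<Longrightarrow> meets n (i, x) (j, y)"
  unfolding meets_def by blast

lemma meetsE:
  assumes "meets n p q"
  obtains i j k x y h h' where "i \<in> cOb C" "j \<in> cOb C" "k \<in> cOb C" "x \<in> Spx (Fo i) n"
    "y \<in> Spx (Fo j) n" "h \<in> cHom C i k" "h' \<in> cHom C j k" "p = (i, x)" "q = (j, y)"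
    "Fm i k h n x = Fm j k h' n y"
  using assms unfolding meets_def by blast

lemma meets_sym: "meets n p q \<Longrightarrow> meets n q p"
  by (elim meetsE) (auto intro: meetsI)

text \<open>Both filteredness conditions are used. The stages where p meets q and where q meets r
  are joined in s, but j then reaches s along two arrows that may differ; w makes them
  equal.\<close>

lemma meets_trans:
  assumes "meets n p q" "meets n q r"
  shows "meets n p r"
proof -
  obtain i j k x y a b where 1: "i \<in> cOb C" "j \<in> cOb C" "k \<in> cOb C" "x \<in> Spx (Fo i) n"
    "y \<in> Spx (Fo j) n" "a \<in> cHom C i k" "b \<in> cHom C j k" "p = (i, x)" "q = (j, y)"
    "Fm i k a n x = Fm j k b n y"
    using assms(1) by (elim meetsE)
  obtain l k' z c d where 2: "l \<in> cOb C" "k' \<in> cOb C" "z \<in> Spx (Fo l) n"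
    "c \<in> cHom C j k'" "d \<in> cHom C l k'" "r = (l, z)" "Fm j k' c n y = Fm l k' d n z"
    using assms(2) 1(9) by (elim meetsE) auto
  obtain s e e' where 3: "s \<in> cOb C" "e \<in> cHom C k s" "e' \<in> cHom C k' s"
    using join_objects[OF 1(3) 2(2)] by blast
  have eb: "cComp C j k s e b \<in> cHom C j s" and ec: "cComp C j k' s e' c \<in> cHom C j s"
    using 1 2 3 by (auto intro: hom_comp)
  obtain t w where 4: "t \<in> cOb C" "w \<in> cHom C s t"
    "cComp C j s t w (cComp C j k s e b) = cComp C j s t w (cComp C j k' s e' c)"
    using coequalize_arrows[OF 1(2) 3(1) eb ec] by blast
  have "Fm i t (cComp C i s t w (cComp C i k s e a)) n x = Fm s t w n (Fm k s e n (Fm i k a n x))"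
    using 1 3 4 by (simp add: Fm_comp hom_comp)
  also have "\<dots> = Fm j t (cComp C j s t w (cComp C j k s e b)) n y"
    using 1 3 4(1,2) by (simp add: Fm_comp hom_comp)
  also have "\<dots> = Fm s t w n (Fm k' s e' n (Fm j k' c n y))"
    unfolding 4(3) using 1 2 3 4(1,2) by (simp add: Fm_comp hom_comp)
  also have "\<dots> = Fm l t (cComp C l s t w (cComp C l k' s e' d)) n z"
    using 2 3 4(1,2) by (simp add: Fm_comp hom_comp)
  finally show ?thesis
    unfolding \<open>p = (i, x)\<close> \<open>r = (l, z)\<close>
    using 1 2 3 4(1,2) by (intro meetsI[of i l t x n z]) (auto intro: hom_comp)
qed

lemma gen_meets: "colim_gen C Fo Fm n p q \<Longrightarrow> meets n p q"
proof -
  assume "colim_gen C Fo Fm n p q"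
  then obtain i j h x where 1: "i \<in> cOb C" "j \<in> cOb C" "h \<in> cHom C i j" "x \<in> Spx (Fo i) n"
    "p = (i, x)" "q = (j, Fm i j h n x)"
    unfolding colim_gen_def by blast
  then have "Fm i j h n x \<in> Spx (Fo j) n" "Fm i j h n x = Fm j j (cId C j) n (Fm i j h n x)"
    by (simp_all add: Fm_in Fm_id)
  then show "meets n p q"
    unfolding 1(5,6) using 1 hom_id by (blast intro: meetsI)
qed

text \<open>Induction along a zigzag of generators. The left pair must be genuine because
  \<open>rel\<close> is reflexive everywhere and \<open>meets\<close> is not; that \<open>q\<close>
  is genuine is then part of the conclusion.\<close>

lemma rel_iff_meets:
  assumes "i \<in> cOb C" "x \<in> Spx (Fo i) n"
  shows "((i, x), q) \<in> rel n \<longleftrightarrow> meets n (i, x) q"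
proof
  assume "((i, x), q) \<in> rel n"
  then have "equivclp (colim_gen C Fo Fm n) (i, x) q" by (simp add: colim_rel_def)
  then show "meets n (i, x) q"
  proof (induction rule: equivclp_induct)
    case base
    then show ?case using assms hom_id by (blast intro: meetsI)
  next
    case (step y z)
    then show ?case using gen_meets meets_sym meets_trans by blast
  qed
next
  assume "meets n (i, x) q"
  then obtain j k y h h' where "j \<in> cOb C" "k \<in> cOb C" "y \<in> Spx (Fo j) n" "h \<in> cHom C i k"
    "h' \<in> cHom C j k" "q = (j, y)" "Fm i k h n x = Fm j k h' n y"
    by (elim meetsE) auto
  moreover from this have "((i, x), (k, Fm i k h n x)) \<in> rel n"
    "((j, y), (k, Fm i k h n x)) \<in> rel n"
    using assms rel_Fm[of i k h x n] rel_Fm[of j k h' y n] by auto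
  ultimately show "((i, x), q) \<in> rel n"
    using rel_sym rel_trans by blast
qed

lemma rel_act:
  assumes "((i, x), (j, y)) \<in> rel n" "i \<in> cOb C" "x \<in> Spx (Fo i) n" "\<alpha> \<in> simplex_arr m n"
  shows "((i, act (Fo i) m n \<alpha> x), (j, act (Fo j) m n \<alpha> y)) \<in> rel m"
proof -
  obtain k h h' where k: "j \<in> cOb C" "k \<in> cOb C" "y \<in> Spx (Fo j) n" "h \<in> cHom C i k"
    "h' \<in> cHom C j k" "Fm i k h n x = Fm j k h' n y"
    using assms(1) rel_iff_meets[OF assms(2,3)] by (auto elim: meetsE)
  have "Fm i k h m (act (Fo i) m n \<alpha> x) = Fm j k h' m (act (Fo j) m n \<alpha> y)"
    using k assms by (simp add: simplicial_map_act[OF Fm_map])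
  then have "meets m (i, act (Fo i) m n \<alpha> x) (j, act (Fo j) m n \<alpha> y)"
    using k assms by (intro meetsI[of i j k]) (auto intro: Fo_sset simplicial_set_act_in)
  then show ?thesis using assms by (simp add: Fo_sset simplicial_set_act_in rel_iff_meets)
qed

section \<open>Simplices of the colimit as classes of representatives\<close>

definition cls :: "nat \<Rightarrow> 'j \<Rightarrow> 'a \<Rightarrow> ('j \<times> 'a) set" where
  "cls n i x = rel n `` {(i, x)}"

lemma cls_eq_iff:
  "i \<in> cOb C \<Longrightarrow> x \<in> Spx (Fo i) n \<Longrightarrow> cls n i x = cls n j y \<longleftrightarrow> ((i, x), (j, y)) \<in> rel n"
  unfolding cls_def using eq_equiv_class_iff[OF equiv_rel] by blast

lemma cls_Fm:
  "i \<in> cOb C \<Longrightarrow> j \<in> cOb C \<Longrightarrow> h \<in> cHom C i j \<Longrightarrow> x \<in> Spx (Fo i) n \<Longrightarrow>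
    cls n j (Fm i j h n x) = cls n i x"
  using rel_Fm cls_eq_iff by metis

lemma cls_in: "i \<in> cOb C \<Longrightarrow> x \<in> Spx (Fo i) n \<Longrightarrow> cls n i x \<in> Spx colim n"
  unfolding sset_colim_def cls_def by (auto intro: quotientI)

lemma colim_cases:
  assumes "c \<in> Spx colim n"
  obtains i x where "i \<in> cOb C" "x \<in> Spx (Fo i) n" "c = cls n i x"
  using assms unfolding sset_colim_def cls_def by (auto elim!: quotientE)

text \<open>The operator of \<open>sset_colim\<close> acts on every representative and saturates the
  result, so this is the well-definedness of the structure maps: by \<open>rel_act\<close> the whole
  image lies in one class.\<close>

lemma act_cls:
  assumes "i \<in> cOb C" "x \<in> Spx (Fo i) n" "\<alpha> \<in> simplex_arr m n"
  shows "act colim m n \<alpha> (cls n i x) = cls m i (act (Fo i) m n \<alpha> x)"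
proof -
  let ?img = "(\<lambda>(j, y). (j, act (Fo j) m n \<alpha> y)) ` cls n i x"
  have "((i, act (Fo i) m n \<alpha> x), p) \<in> rel m" if "p \<in> ?img" for p
    using that rel_act assms unfolding cls_def by auto
  moreover have "(i, act (Fo i) m n \<alpha> x) \<in> ?img"
    unfolding cls_def using equiv_class_self[OF equiv_rel, of "(i, x)" n] by force
  ultimately have "rel m `` ?img = cls m i (act (Fo i) m n \<alpha> x)"
    unfolding cls_def[of m] by (blast intro: rel_trans)
  then show ?thesis by (simp add: sset_colim_def)
qed

lemma simplicial_set_colim: "simplicial_set colim"
  unfolding simplicial_set_def
proof (intro conjI allI ballI)
  fix m n \<alpha> c assume "\<alpha> \<in> simplex_arr m n" "c \<in> Spx colim n"
  then show "act colim m n \<alpha> c \<in> Spx colim m"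
    by (elim colim_cases) (simp add: act_cls cls_in simplicial_set_act_in Fo_sset)
next
  fix n c assume "c \<in> Spx colim n"
  then show "act colim n n (\<lambda>i\<in>{..n}. i) c = c"
    by (elim colim_cases) (simp only: act_cls simplex_arr_id simplicial_set_act_id Fo_sset)
next
  fix l m n \<beta> \<alpha> c
  assume "\<beta> \<in> simplex_arr l m" "\<alpha> \<in> simplex_arr m n" "c \<in> Spx colim n"
  then show "act colim l m \<beta> (act colim m n \<alpha> c) = act colim l n (compose {..l} \<alpha> \<beta>) c"
    by (elim colim_cases)
      (simp add: act_cls simplicial_set_act_in Fo_sset simplex_arr_compose simplicial_set_act_act)
qed

text \<open>Each new element is joined with the stage reached so far, and the earlier choices are
  transported along. The empty family uses that the index category is nonempty.\<close>

lemma common_index: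
  assumes "finite A" "\<And>a. a \<in> A \<Longrightarrow> c a \<in> Spx colim n"
  shows "\<exists>i\<in>cOb C. \<exists>x. \<forall>a\<in>A. x a \<in> Spx (Fo i) n \<and> c a = cls n i (x a)"
  using assms
proof (induction A)
  case empty
  then show ?case using filtered unfolding filtered_category_def by auto
next
  case (insert a A)
  then obtain i x where i: "i \<in> cOb C" "\<forall>b\<in>A. x b \<in> Spx (Fo i) n \<and> c b = cls n i (x b)" by auto
  obtain j y where j: "j \<in> cOb C" "y \<in> Spx (Fo j) n" "c a = cls n j y"
    using insert.prems colim_cases by (metis insertI1)
  obtain k h h' where k: "k \<in> cOb C" "h \<in> cHom C i k" "h' \<in> cHom C j k"
    using join_objects i j by metis
  show ?case
    using i j k Fm_in cls_Fm
    by (intro bexI[of _ k] exI[of _ "\<lambda>b. if b = a then Fm j k h' n y else Fm i k h n (x b)"]) auto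
qed

text \<open>Finitely many equations that hold in the colimit already hold after transport along one
  arrow. A later transport preserves equations, so they can be treated one by one.\<close>

lemma common_equalizer:
  assumes "finite A" "i \<in> cOb C"
    and "\<And>a. a \<in> A \<Longrightarrow> x a \<in> Spx (Fo i) n \<and> y a \<in> Spx (Fo i) n \<and> cls n i (x a) = cls n i (y a)"
  shows "\<exists>j\<in>cOb C. \<exists>h\<in>cHom C i j. \<forall>a\<in>A. Fm i j h n (x a) = Fm i j h n (y a)"
  using assms(1,3)
proof (induction A)
  case empty
  then show ?case using assms(2) hom_id by auto
next
  case (insert a A)
  then obtain j h where j: "j \<in> cOb C" "h \<in> cHom C i j" "\<forall>b\<in>A. Fm i j h n (x b) = Fm i j h n (y b)"
    by auto
  have xy: "x b \<in> Spx (Fo i) n \<and> y b \<in> Spx (Fo i) n" if "b \<in> insert a A" for b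
    using insert.prems that by blast
  have "cls n j (Fm i j h n (x a)) = cls n j (Fm i j h n (y a))"
    using insert.prems[of a] j assms(2) by (simp add: cls_Fm)
  then have "meets n (j, Fm i j h n (x a)) (j, Fm i j h n (y a))"
    using insert.prems[of a] j assms(2) Fm_in cls_eq_iff rel_iff_meets by simp
  then obtain k e e' where k: "k \<in> cOb C" "e \<in> cHom C j k" "e' \<in> cHom C j k"
    "Fm j k e n (Fm i j h n (x a)) = Fm j k e' n (Fm i j h n (y a))"
    by (elim meetsE) auto
  \<comment> \<open>\<open>e\<close> and \<open>e'\<close> carry the two sides to a common value but
    may be different arrows; after \<open>w\<close> they agree, so the single arrow
    \<open>?h\<close> can be read through either of them.\<close>
  obtain l w where l: "l \<in> cOb C" "w \<in> cHom C k l" "cComp C j k l w e = cComp C j k l w e'"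
    using coequalize_arrows[OF j(1) k(1,2,3)] by blast
  let ?h = "cComp C i j l (cComp C j k l w e) h"
  have via_e: "Fm i l ?h n z = Fm k l w n (Fm j k e n (Fm i j h n z))" if "z \<in> Spx (Fo i) n" for z
    using that assms(2) j(1,2) k(1,2) l(1,2) by (simp add: Fm_comp hom_comp Fm_in)
  have via_e': "Fm i l ?h n z = Fm k l w n (Fm j k e' n (Fm i j h n z))" if "z \<in> Spx (Fo i) n" for z
    unfolding l(3) using that assms(2) j(1,2) k(1,3) l(1,2) by (simp add: Fm_comp hom_comp Fm_in)
  have "Fm i l ?h n (x b) = Fm i l ?h n (y b)" if b: "b \<in> insert a A" for b
  proof (cases "b = a")
    case True
    then show ?thesis using xy[OF b] k(4) via_e[of "x a"] via_e'[of "y a"] by simp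
  next
    case False
    then show ?thesis using xy[OF b] b j(3) by (simp add: via_e)
  qed
  moreover have "?h \<in> cHom C i l" using assms(2) j k l by (simp add: hom_comp)
  ultimately show ?case using l(1) by blast
qed

lemma kan_complex_colim:
  assumes kan: "\<And>i. i \<in> cOb C \<Longrightarrow> kan_complex (Fo i)"
  shows "kan_complex colim"
  unfolding kan_complex_def
proof (intro conjI allI impI simplicial_set_colim)
  fix n k \<phi> assume n: "1 \<le> n" and k: "k \<le> n" and \<phi>: "simplicial_map (horn n k) colim \<phi>"
  let ?H = "Spx (horn n k) n"
  have H_def: "\<rho> \<in> Spx (horn n k) m \<longleftrightarrow> \<rho> \<in> simplex_arr m n \<and> insert k (\<rho> ` {..m}) \<noteq> {..n}" for \<rho> m
    by (simp add: horn_def)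
  have act_horn: "act (horn n k) l m \<beta> \<rho> = compose {..l} \<rho> \<beta>" for l m \<beta> \<rho>
    by (simp add: horn_def)
  have horn_compose: "compose {..l} \<rho> \<beta> \<in> Spx (horn n k) l"
    if "\<rho> \<in> Spx (horn n k) m" "\<beta> \<in> simplex_arr l m" for \<rho> \<beta> l m
  proof -
    have "compose {..l} \<rho> \<beta> ` {..l} \<subseteq> \<rho> ` {..m}"
      using that(2) simplex_arr_in by (fastforce simp: compose_def)
    moreover have "\<rho> ` {..m} \<subseteq> {..n}" using that simplex_arr_in unfolding H_def by blast
    ultimately have "insert k (compose {..l} \<rho> \<beta> ` {..l}) \<noteq> {..n}"
      using that k unfolding H_def by blast
    then show ?thesis using that simplex_arr_compose unfolding H_def by blast
  qed
  have "finite ?H" by (rule finite_subset[OF _ finite_simplex_arr[of n n]]) (auto simp: H_def)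
  then obtain i x where i: "i \<in> cOb C"
    and x: "\<And>\<rho>. \<rho> \<in> ?H \<Longrightarrow> x \<rho> \<in> Spx (Fo i) n" "\<And>\<rho>. \<rho> \<in> ?H \<Longrightarrow> \<phi> n \<rho> = cls n i (x \<rho>)"
    using common_index[of ?H "\<phi> n" n] simplicial_map_in[OF \<phi>] by blast
  \<comment> \<open>The lifts \<open>x\<close> are chosen independently of each other and need not
    respect the operators. The equations that fail are indexed by the finite set \<open>?A\<close>,
    and they hold in the colimit because \<open>\<phi>\<close> is simplicial.\<close>
  let ?A = "?H \<times> simplex_arr n n"
  have "\<exists>j\<in>cOb C. \<exists>h\<in>cHom C i j. \<forall>a\<in>?A. Fm i j h n ((\<lambda>(\<rho>, \<beta>). x (compose {..n} \<rho> \<beta>)) a) =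
      Fm i j h n ((\<lambda>(\<rho>, \<beta>). act (Fo i) n n \<beta> (x \<rho>)) a)"
  proof (rule common_equalizer[OF _ i], goal_cases)
    case 1
    then show ?case using \<open>finite ?H\<close> finite_simplex_arr by blast
  next
    case (2 a)
    then obtain \<rho> \<beta> where a: "a = (\<rho>, \<beta>)" "\<rho> \<in> ?H" "\<beta> \<in> simplex_arr n n" by auto
    have "cls n i (x (compose {..n} \<rho> \<beta>)) = \<phi> n (act (horn n k) n n \<beta> \<rho>)"
      using a x(2) horn_compose by (simp add: act_horn)
    also have "\<dots> = cls n i (act (Fo i) n n \<beta> (x \<rho>))"
      using a x i by (simp add: simplicial_map_act[OF \<phi>] act_cls)
    finally show ?case
      using a x i horn_compose by (simp add: simplicial_set_act_in Fo_sset)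
  qed
  then obtain j h where j: "j \<in> cOb C" "h \<in> cHom C i j"
    and eq: "\<And>\<rho> \<beta>. \<rho> \<in> ?H \<Longrightarrow> \<beta> \<in> simplex_arr n n \<Longrightarrow>
      Fm i j h n (x (compose {..n} \<rho> \<beta>)) = Fm i j h n (act (Fo i) n n \<beta> (x \<rho>))"
    by auto
  define y where "y \<rho> = Fm i j h n (x \<rho>)" for \<rho>
  have y_in: "y \<rho> \<in> Spx (Fo j) n" and y_cls: "cls n j (y \<rho>) = \<phi> n \<rho>" if "\<rho> \<in> ?H" for \<rho>
    using that x i j by (simp_all add: y_def Fm_in cls_Fm)
  have y_act: "y (compose {..n} \<rho> \<beta>) = act (Fo j) n n \<beta> (y \<rho>)"
    if "\<rho> \<in> ?H" "\<beta> \<in> simplex_arr n n" for \<rho> \<beta>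
    using eq[OF that] that i j x by (simp add: y_def simplicial_map_act[OF Fm_map])
  define r where "r m \<alpha> = simplex_retraction n (\<alpha> ` {..m})" for m and \<alpha> :: "nat \<Rightarrow> nat"
  have im: "\<alpha> ` {..m} \<subseteq> {..n}" "\<alpha> ` {..m} \<noteq> {}" if "\<alpha> \<in> Spx (horn n k) m" for \<alpha> m
    using that simplex_arr_in unfolding H_def by auto
  \<comment> \<open>Whether a simplex lies in the horn depends only on its image, and the retraction
    has the same image as \<open>\<alpha>\<close>.\<close>
  have r_in: "r m \<alpha> \<in> ?H" if "\<alpha> \<in> Spx (horn n k) m" for \<alpha> m
    using that im[OF that] simplex_retraction_arr simplex_retraction_image
    unfolding H_def r_def by simp
  have r_arr: "r m \<alpha> \<in> simplex_arr n n" if "\<alpha> \<in> Spx (horn n k) m" for \<alpha> m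
    using r_in[OF that] by (simp add: H_def)
  have r_fix: "compose {..l} (r m \<alpha>) \<beta> = \<beta>"
    if "\<alpha> \<in> Spx (horn n k) m" "\<beta> \<in> simplex_arr l n" "\<beta> ` {..l} \<subseteq> \<alpha> ` {..m}" for \<alpha> \<beta> l m
    unfolding r_def using that im by (intro compose_simplex_retraction) auto
  text \<open>Every simplex \<open>\<alpha>\<close> of the horn is the pullback along \<open>\<alpha>\<close> of the n-simplex \<open>r m \<alpha>\<close> of the
    horn, so the finitely many n-simplices determine the lift in all dimensions.\<close>
  define \<phi>' where "\<phi>' m \<alpha> = act (Fo j) m n \<alpha> (y (r m \<alpha>))" for m \<alpha>
  have "simplicial_map (horn n k) (Fo j) \<phi>'"
    unfolding simplicial_map_def
  proof (intro conjI allI ballI)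
    fix m \<alpha> assume \<alpha>: "\<alpha> \<in> Spx (horn n k) m"
    then have "\<alpha> \<in> simplex_arr m n" by (simp add: H_def)
    then show "\<phi>' m \<alpha> \<in> Spx (Fo j) m"
      unfolding \<phi>'_def by (rule simplicial_set_act_in[OF Fo_sset[OF j(1)] _ y_in[OF r_in[OF \<alpha>]]])
  next
    fix l m \<beta> \<alpha> assume \<beta>: "\<beta> \<in> simplex_arr l m" and \<alpha>: "\<alpha> \<in> Spx (horn n k) m"
    let ?\<gamma> = "compose {..l} \<alpha> \<beta>"
    have \<gamma>: "?\<gamma> \<in> Spx (horn n k) l" using horn_compose \<alpha> \<beta> by blast
    then have \<gamma>_arr: "?\<gamma> \<in> simplex_arr l n" and \<alpha>_arr: "\<alpha> \<in> simplex_arr m n"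
      using \<alpha> by (auto simp: H_def)
    have sub: "?\<gamma> ` {..l} \<subseteq> \<alpha> ` {..m}"
      using \<beta> simplex_arr_in by (fastforce simp: compose_def)
    \<comment> \<open>The retractions for \<open>\<alpha>\<close> and for its restriction differ.
      Since the image of the restriction is smaller, its retraction is the other one precomposed
      with an endomorphism of [n], and for those \<open>y\<close> is known to be compatible.\<close>
    have "r l ?\<gamma> ` {..n} = ?\<gamma> ` {..l}"
      unfolding r_def using im[OF \<gamma>] by (rule simplex_retraction_image)
    then have "compose {..n} (r m \<alpha>) (r l ?\<gamma>) = r l ?\<gamma>"
      using r_fix[OF \<alpha> r_arr[OF \<gamma>]] sub by simp
    then have "y (r l ?\<gamma>) = act (Fo j) n n (r l ?\<gamma>) (y (r m \<alpha>))"
      using y_act[OF r_in[OF \<alpha>] r_arr[OF \<gamma>]] by simp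
    then have "\<phi>' l ?\<gamma> = act (Fo j) l n (compose {..l} (r l ?\<gamma>) ?\<gamma>) (y (r m \<alpha>))"
      using simplicial_set_act_act[OF Fo_sset[OF j(1)] \<gamma>_arr r_arr[OF \<gamma>] y_in[OF r_in[OF \<alpha>]]]
      by (simp add: \<phi>'_def)
    also have "compose {..l} (r l ?\<gamma>) ?\<gamma> = ?\<gamma>"
      using r_fix[OF \<gamma> \<gamma>_arr] by simp
    also have "act (Fo j) l n ?\<gamma> (y (r m \<alpha>)) = act (Fo j) l m \<beta> (\<phi>' m \<alpha>)"
      using simplicial_set_act_act[OF Fo_sset[OF j(1)] \<beta> \<alpha>_arr y_in[OF r_in[OF \<alpha>]]]
      by (simp add: \<phi>'_def)
    finally show "\<phi>' l (act (horn n k) l m \<beta> \<alpha>) = act (Fo j) l m \<beta> (\<phi>' m \<alpha>)"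
      by (simp add: act_horn)
  qed
  then obtain \<psi> where \<psi>: "simplicial_map (std_simplex n) (Fo j) \<psi>"
    and ext: "\<And>m \<alpha>. \<alpha> \<in> Spx (horn n k) m \<Longrightarrow> \<psi> m \<alpha> = \<phi>' m \<alpha>"
    using kan[OF j(1)] n k unfolding kan_complex_def by blast
  show "\<exists>\<psi>. simplicial_map (std_simplex n) colim \<psi> \<and> (\<forall>m. \<forall>\<alpha>\<in>Spx (horn n k) m. \<psi> m \<alpha> = \<phi> m \<alpha>)"
  proof (intro exI[of _ "\<lambda>m \<alpha>. cls m j (\<psi> m \<alpha>)"] conjI allI ballI)
    show "simplicial_map (std_simplex n) colim (\<lambda>m \<alpha>. cls m j (\<psi> m \<alpha>))"
      unfolding simplicial_map_def
    proof (intro conjI allI ballI)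
      fix m \<alpha> assume "\<alpha> \<in> Spx (std_simplex n) m"
      then show "cls m j (\<psi> m \<alpha>) \<in> Spx colim m" by (intro cls_in j simplicial_map_in[OF \<psi>])
    next
      fix l m \<beta> \<alpha> assume "\<beta> \<in> simplex_arr l m" "\<alpha> \<in> Spx (std_simplex n) m"
      then show "cls l j (\<psi> l (act (std_simplex n) l m \<beta> \<alpha>)) = act colim l m \<beta> (cls m j (\<psi> m \<alpha>))"
        using j simplicial_map_in[OF \<psi>] by (simp add: simplicial_map_act[OF \<psi>] act_cls)
    qed
  next
    fix m \<alpha> assume \<alpha>: "\<alpha> \<in> Spx (horn n k) m"
    then have \<alpha>_arr: "\<alpha> \<in> simplex_arr m n" by (simp add: H_def)
    \<comment> \<open>In the colimit the lift of the n-simplex \<open>r m \<alpha>\<close>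
      represents its value under \<open>\<phi>\<close>, so simpliciality of \<open>\<phi>\<close>
      recovers the value at \<open>\<alpha>\<close>.\<close>
    have "cls m j (\<psi> m \<alpha>) = act colim m n \<alpha> (\<phi> n (r m \<alpha>))"
      using j \<alpha>_arr y_in[OF r_in[OF \<alpha>]] y_cls[OF r_in[OF \<alpha>]] act_cls[of j "y (r m \<alpha>)" n \<alpha> m]
      by (simp add: ext[OF \<alpha>] \<phi>'_def)
    also have "\<dots> = \<phi> m (compose {..m} (r m \<alpha>) \<alpha>)"
      using simplicial_map_act[OF \<phi> \<alpha>_arr r_in[OF \<alpha>]] by (simp add: act_horn)
    also have "compose {..m} (r m \<alpha>) \<alpha> = \<alpha>"
      using r_fix[OF \<alpha> \<alpha>_arr] by simp
    finally show "cls m j (\<psi> m \<alpha>) = \<phi> m \<alpha>" .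
  qed
qed

end

section \<open>Simplicial categories with finite products\<close>

locale simplicial_products =
  fixes K :: "('o, 'a) scat" and P :: "('o, 'a) fin_products"
  assumes scat: "simplicial_category K" and fin_products: "are_fin_products K P"
begin

abbreviation hom :: "nat \<Rightarrow> 'o \<Rightarrow> 'o \<Rightarrow> 'a set" where
  "hom n X Y \<equiv> Spx (Map K X Y) n"

abbreviation proj1 :: "nat \<Rightarrow> 'o \<Rightarrow> 'o \<Rightarrow> 'a" where
  "proj1 n X Y \<equiv> const_spx K n (prd P X Y) X (pr1 P X Y)"

abbreviation proj2 :: "nat \<Rightarrow> 'o \<Rightarrow> 'o \<Rightarrow> 'a" where
  "proj2 n X Y \<equiv> const_spx K n (prd P X Y) Y (pr2 P X Y)"

abbreviation idn :: "nat \<Rightarrow> 'o \<Rightarrow> 'a" where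
  "idn n X \<equiv> const_spx K n X X (Ident K X)"

lemma sset_Map: "X \<in> Obj K \<Longrightarrow> Y \<in> Obj K \<Longrightarrow> simplicial_set (Map K X Y)"
  using scat by (simp add: simplicial_category_def)

lemma Comp_map:
  "X \<in> Obj K \<Longrightarrow> Y \<in> Obj K \<Longrightarrow> Z \<in> Obj K \<Longrightarrow>
    simplicial_map (sset_prod (Map K Y Z) (Map K X Y)) (Map K X Z) (\<lambda>n (g, f). Comp K n X Y Z g f)"
  using scat by (simp add: simplicial_category_def)

lemma Comp_in:
  assumes "X \<in> Obj K" "Y \<in> Obj K" "Z \<in> Obj K" "f \<in> hom n X Y" "g \<in> hom n Y Z"
  shows "Comp K n X Y Z g f \<in> hom n X Z"
  using simplicial_map_in[OF Comp_map[OF assms(1-3)], of "(g, f)" n] assms(4,5)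
  by (simp add: sset_prod_def)

lemma act_Comp:
  assumes "X \<in> Obj K" "Y \<in> Obj K" "Z \<in> Obj K" "f \<in> hom n X Y" "g \<in> hom n Y Z"
    "\<alpha> \<in> simplex_arr m n"
  shows "act (Map K X Z) m n \<alpha> (Comp K n X Y Z g f) =
    Comp K m X Y Z (act (Map K Y Z) m n \<alpha> g) (act (Map K X Y) m n \<alpha> f)"
  using simplicial_map_act[OF Comp_map[OF assms(1-3)] assms(6), of "(g, f)"] assms(4,5)
  by (simp add: sset_prod_def)

lemma Ident_in: "X \<in> Obj K \<Longrightarrow> Ident K X \<in> hom 0 X X"
  using scat by (simp add: simplicial_category_def)

lemma Comp_Ident_right:
  "X \<in> Obj K \<Longrightarrow> Y \<in> Obj K \<Longrightarrow> f \<in> hom n X Y \<Longrightarrow> Comp K n X X Y f (idn n X) = f"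
  using scat by (simp add: simplicial_category_def)

lemma Comp_Ident_left:
  "X \<in> Obj K \<Longrightarrow> Y \<in> Obj K \<Longrightarrow> f \<in> hom n X Y \<Longrightarrow> Comp K n X Y Y (idn n Y) f = f"
  using scat by (simp add: simplicial_category_def)

lemma Comp_assoc:
  "W \<in> Obj K \<Longrightarrow> X \<in> Obj K \<Longrightarrow> Y \<in> Obj K \<Longrightarrow> Z \<in> Obj K \<Longrightarrow>
    f \<in> hom n W X \<Longrightarrow> g \<in> hom n X Y \<Longrightarrow> h \<in> hom n Y Z \<Longrightarrow>
    Comp K n W X Z (Comp K n X Y Z h g) f = Comp K n W Y Z h (Comp K n W X Y g f)"
  using scat by (simp add: simplicial_category_def)

lemma act_in:
  "X \<in> Obj K \<Longrightarrow> Y \<in> Obj K \<Longrightarrow> f \<in> hom n X Y \<Longrightarrow> \<alpha> \<in> simplex_arr m n \<Longrightarrow>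
    act (Map K X Y) m n \<alpha> f \<in> hom m X Y"
  by (simp add: simplicial_set_act_in sset_Map)

lemma const_in: "X \<in> Obj K \<Longrightarrow> Y \<in> Obj K \<Longrightarrow> s \<in> hom 0 X Y \<Longrightarrow> const_spx K n X Y s \<in> hom n X Y"
  unfolding const_spx_def by (simp only: act_in simplex_arr_zero)

lemma act_const:
  "X \<in> Obj K \<Longrightarrow> Y \<in> Obj K \<Longrightarrow> s \<in> hom 0 X Y \<Longrightarrow> \<alpha> \<in> simplex_arr m n \<Longrightarrow>
    act (Map K X Y) m n \<alpha> (const_spx K n X Y s) = const_spx K m X Y s"
  unfolding const_spx_def
  by (simp only: simplicial_set_act_act[OF sset_Map _ simplex_arr_zero] compose_simplex_arr_zero)

lemma const_0: "X \<in> Obj K \<Longrightarrow> Y \<in> Obj K \<Longrightarrow> s \<in> hom 0 X Y \<Longrightarrow> const_spx K 0 X Y s = s"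
proof -
  assume "X \<in> Obj K" "Y \<in> Obj K" "s \<in> hom 0 X Y"
  moreover have "(\<lambda>i\<in>{..0::nat}. 0::nat) = (\<lambda>i\<in>{..0}. i)" by auto
  ultimately show ?thesis
    unfolding const_spx_def by (simp only: simplicial_set_act_id[OF sset_Map])
qed

lemma const_Comp:
  "X \<in> Obj K \<Longrightarrow> Y \<in> Obj K \<Longrightarrow> Z \<in> Obj K \<Longrightarrow> f \<in> hom 0 X Y \<Longrightarrow> g \<in> hom 0 Y Z \<Longrightarrow>
    const_spx K n X Z (Comp K 0 X Y Z g f) =
      Comp K n X Y Z (const_spx K n Y Z g) (const_spx K n X Y f)"
  unfolding const_spx_def by (simp only: act_Comp simplex_arr_zero)

section \<open>Finite products at each simplicial level\<close>

lemma one_in: "one P \<in> Obj K"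
  using fin_products by (simp add: are_fin_products_def is_sterminal_def)

lemma
  assumes "X \<in> Obj K" "Y \<in> Obj K"
  shows prd_in: "prd P X Y \<in> Obj K"
    and pr1_in: "pr1 P X Y \<in> hom 0 (prd P X Y) X"
    and pr2_in: "pr2 P X Y \<in> hom 0 (prd P X Y) Y"
  using fin_products assms by (simp_all add: are_fin_products_def is_sproduct_def)

lemma pairing_ex1:
  assumes "X \<in> Obj K" "Y \<in> Obj K" "Z \<in> Obj K" "f \<in> hom n Z X" "g \<in> hom n Z Y"
  shows "\<exists>!t. t \<in> hom n Z (prd P X Y) \<and> Comp K n Z (prd P X Y) X (proj1 n X Y) t = f \<and>
    Comp K n Z (prd P X Y) Y (proj2 n X Y) t = g"
proof -
  have "is_sproduct K X Y (prd P X Y) (pr1 P X Y) (pr2 P X Y)"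
    using fin_products assms by (simp add: are_fin_products_def)
  then show ?thesis using assms unfolding is_sproduct_def by simp
qed

lemma
  assumes "X \<in> Obj K" "Y \<in> Obj K" "Z \<in> Obj K" "f \<in> hom n Z X" "g \<in> hom n Z Y"
  shows pairing_in: "pairing K P n Z X Y f g \<in> hom n Z (prd P X Y)"
    and proj1_pairing: "Comp K n Z (prd P X Y) X (proj1 n X Y) (pairing K P n Z X Y f g) = f"
    and proj2_pairing: "Comp K n Z (prd P X Y) Y (proj2 n X Y) (pairing K P n Z X Y f g) = g"
  using theI'[OF pairing_ex1[OF assms]] unfolding pairing_def by blast+

lemma pairing_unique:
  assumes "X \<in> Obj K" "Y \<in> Obj K" "Z \<in> Obj K" "f \<in> hom n Z X" "g \<in> hom n Z Y"
    "t \<in> hom n Z (prd P X Y)" "Comp K n Z (prd P X Y) X (proj1 n X Y) t = f"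
    "Comp K n Z (prd P X Y) Y (proj2 n X Y) t = g"
  shows "t = pairing K P n Z X Y f g"
  unfolding pairing_def
  by (rule the1_equality[symmetric, OF pairing_ex1[OF assms(1-5)]]) (simp add: assms)

lemmas objects_in = one_in prd_in
lemmas spx_in = Comp_in const_in Ident_in pr1_in pr2_in pairing_in

lemma pairing_Comp:
  assumes "X \<in> Obj K" "Y \<in> Obj K" "Z \<in> Obj K" "W \<in> Obj K" "f \<in> hom n Z X" "g \<in> hom n Z Y"
    "h \<in> hom n W Z"
  shows "Comp K n W Z (prd P X Y) (pairing K P n Z X Y f g) h =
    pairing K P n W X Y (Comp K n W Z X f h) (Comp K n W Z Y g h)"
  by (rule pairing_unique)
    (use assms in \<open>simp_all add: objects_in spx_in proj1_pairing proj2_pairing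
       Comp_assoc[symmetric]\<close>)

text \<open>Pairings are chosen separately in each dimension. They are compatible because the
  projections are totally degenerate, hence preserved by every operator, and pairings are
  unique.\<close>

lemma act_pairing:
  assumes "X \<in> Obj K" "Y \<in> Obj K" "Z \<in> Obj K" "f \<in> hom n Z X" "g \<in> hom n Z Y"
    "\<alpha> \<in> simplex_arr m n"
  shows "act (Map K Z (prd P X Y)) m n \<alpha> (pairing K P n Z X Y f g) =
    pairing K P m Z X Y (act (Map K Z X) m n \<alpha> f) (act (Map K Z Y) m n \<alpha> g)"
proof (rule pairing_unique)
  have "Comp K m Z (prd P X Y) X (proj1 m X Y) (act (Map K Z (prd P X Y)) m n \<alpha> (pairing K P n Z X Y f g)) =
      act (Map K Z X) m n \<alpha> (Comp K n Z (prd P X Y) X (proj1 n X Y) (pairing K P n Z X Y f g))"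
    using assms by (simp add: act_Comp act_const objects_in spx_in)
  then show "Comp K m Z (prd P X Y) X (proj1 m X Y) (act (Map K Z (prd P X Y)) m n \<alpha> (pairing K P n Z X Y f g)) =
      act (Map K Z X) m n \<alpha> f"
    using assms by (simp add: proj1_pairing)
  have "Comp K m Z (prd P X Y) Y (proj2 m X Y) (act (Map K Z (prd P X Y)) m n \<alpha> (pairing K P n Z X Y f g)) =
      act (Map K Z Y) m n \<alpha> (Comp K n Z (prd P X Y) Y (proj2 n X Y) (pairing K P n Z X Y f g))"
    using assms by (simp add: act_Comp act_const objects_in spx_in)
  then show "Comp K m Z (prd P X Y) Y (proj2 m X Y) (act (Map K Z (prd P X Y)) m n \<alpha> (pairing K P n Z X Y f g)) =
      act (Map K Z Y) m n \<alpha> g"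
    using assms by (simp add: proj2_pairing)
qed (use assms in \<open>simp_all add: act_in objects_in spx_in\<close>)

lemma const_pairing:
  "X \<in> Obj K \<Longrightarrow> Y \<in> Obj K \<Longrightarrow> Z \<in> Obj K \<Longrightarrow> f \<in> hom 0 Z X \<Longrightarrow> g \<in> hom 0 Z Y \<Longrightarrow>
    const_spx K n Z (prd P X Y) (pairing K P 0 Z X Y f g) =
      pairing K P n Z X Y (const_spx K n Z X f) (const_spx K n Z Y g)"
  unfolding const_spx_def by (simp only: act_pairing simplex_arr_zero)

text \<open>Together these rules normalize composites built from projections and pairings: composition is
  associated to the right, pushed into pairings, and cancelled against projections.\<close>

lemmas product_calculus = objects_in spx_in Comp_Ident_left Comp_Ident_right Comp_assoc
  pairing_Comp proj1_pairing proj2_pairing const_0 const_Comp const_pairing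

section \<open>Restriction and composition of representatives\<close>

lemma prod_spx_in:
  "A \<in> Obj K \<Longrightarrow> B \<in> Obj K \<Longrightarrow> C \<in> Obj K \<Longrightarrow> D \<in> Obj K \<Longrightarrow> f \<in> hom n A B \<Longrightarrow> g \<in> hom n C D \<Longrightarrow>
    prod_spx K P n A B C D f g \<in> hom n (prd P A C) (prd P B D)"
  unfolding prod_spx_def by (simp add: product_calculus)

lemma prod_assoc_in:
  "X \<in> Obj K \<Longrightarrow> U \<in> Obj K \<Longrightarrow> V \<in> Obj K \<Longrightarrow>
    prod_assoc K P X U V \<in> hom 0 (prd P X (prd P U V)) (prd P (prd P X U) V)"
  unfolding prod_assoc_def Let_def by (simp add: product_calculus)

text \<open>The normal form (x, u') |-> f (x, h u'), from which the rules of
  \<open>product_calculus\<close> can compute.\<close>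

lemma filter_diag_mor_eq:
  assumes "X \<in> Obj K" "Y \<in> Obj K" "U \<in> Obj K" "U' \<in> Obj K" "h \<in> hom 0 U' U"
    "f \<in> hom n (prd P X U) Y"
  shows "filter_diag_mor K P X Y U U' h n f =
    Comp K n (prd P X U') (prd P X U) Y f
      (pairing K P n (prd P X U') X U (proj1 n X U')
        (Comp K n (prd P X U') U' U (const_spx K n U' U h) (proj2 n X U')))"
  using assms unfolding filter_diag_mor_def prod_spx_def by (simp add: product_calculus)

text \<open>In generalized elements, (x, (u, v)) |-> g (f (x, u), v). The associator has been
  absorbed into the pairings.\<close>

lemma filter_comp_rep_eq:
  assumes "X \<in> Obj K" "Y \<in> Obj K" "Z \<in> Obj K" "U \<in> Obj K" "V \<in> Obj K"
    "f \<in> hom n (prd P X U) Y" "g \<in> hom n (prd P Y V) Z"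
  shows "filter_comp_rep K P n X Y Z U V g f =
    (let W = prd P U V; Q = prd P X W in
     Comp K n Q (prd P Y V) Z g
      (pairing K P n Q Y V
        (Comp K n Q (prd P X U) Y f
          (pairing K P n Q X U (proj1 n X W) (Comp K n Q W U (proj1 n U V) (proj2 n X W))))
        (Comp K n Q W V (proj2 n U V) (proj2 n X W))))"
  using assms unfolding filter_comp_rep_def prod_spx_def prod_assoc_def Let_def
  by (simp add: product_calculus)

lemma filter_diag_mor_in:
  assumes "X \<in> Obj K" "Y \<in> Obj K" "U \<in> Obj K" "U' \<in> Obj K" "h \<in> hom 0 U' U"
    "f \<in> hom n (prd P X U) Y"
  shows "filter_diag_mor K P X Y U U' h n f \<in> hom n (prd P X U') Y"
  using assms by (simp add: filter_diag_mor_eq product_calculus)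

lemma filter_comp_rep_in:
  assumes "X \<in> Obj K" "Y \<in> Obj K" "Z \<in> Obj K" "U \<in> Obj K" "V \<in> Obj K"
    "f \<in> hom n (prd P X U) Y" "g \<in> hom n (prd P Y V) Z"
  shows "filter_comp_rep K P n X Y Z U V g f \<in> hom n (prd P X (prd P U V)) Z"
  using assms by (simp add: filter_comp_rep_eq Let_def product_calculus)

lemma filter_diag_mor_Ident:
  assumes "X \<in> Obj K" "Y \<in> Obj K" "U \<in> Obj K" "f \<in> hom n (prd P X U) Y"
  shows "filter_diag_mor K P X Y U U (Ident K U) n f = f"
proof -
  \<comment> \<open>The rules of \<open>product_calculus\<close> do not contract a pairing of
    projections to an identity; that comes from uniqueness.\<close>
  have "pairing K P n (prd P X U) X U (proj1 n X U) (proj2 n X U) = idn n (prd P X U)"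
    using assms by (intro pairing_unique[symmetric]) (simp_all add: product_calculus)
  then show ?thesis using assms by (simp add: filter_diag_mor_eq product_calculus)
qed

lemma filter_diag_mor_Comp:
  assumes "X \<in> Obj K" "Y \<in> Obj K" "U \<in> Obj K" "V \<in> Obj K" "W \<in> Obj K"
    "h \<in> hom 0 V U" "h' \<in> hom 0 W V" "f \<in> hom n (prd P X U) Y"
  shows "filter_diag_mor K P X Y U W (Comp K 0 W V U h h') n f =
    filter_diag_mor K P X Y V W h' n (filter_diag_mor K P X Y U V h n f)"
  using assms by (simp add: filter_diag_mor_eq product_calculus)

lemma act_filter_diag_mor:
  assumes "X \<in> Obj K" "Y \<in> Obj K" "U \<in> Obj K" "U' \<in> Obj K" "h \<in> hom 0 U' U"
    "f \<in> hom n (prd P X U) Y" "\<alpha> \<in> simplex_arr m n"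
  shows "filter_diag_mor K P X Y U U' h m (act (Map K (prd P X U) Y) m n \<alpha> f) =
    act (Map K (prd P X U') Y) m n \<alpha> (filter_diag_mor K P X Y U U' h n f)"
  using assms by (simp add: filter_diag_mor_eq objects_in spx_in act_in act_Comp act_pairing act_const)

lemma act_filter_comp_rep:
  assumes "X \<in> Obj K" "Y \<in> Obj K" "Z \<in> Obj K" "U \<in> Obj K" "V \<in> Obj K"
    "f \<in> hom n (prd P X U) Y" "g \<in> hom n (prd P Y V) Z" "\<alpha> \<in> simplex_arr m n"
  shows "act (Map K (prd P X (prd P U V)) Z) m n \<alpha> (filter_comp_rep K P n X Y Z U V g f) =
    filter_comp_rep K P m X Y Z U V
      (act (Map K (prd P Y V) Z) m n \<alpha> g) (act (Map K (prd P X U) Y) m n \<alpha> f)"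
  using assms
  by (simp add: filter_comp_rep_eq Let_def objects_in spx_in act_in act_Comp act_pairing act_const)

text \<open>Both sides are (x, (u', v)) |-> g (f (x, h u'), v). "Right" refers to the position of f
  in g (f x id). Restricting a factor restricts the composite along an arrow of the filter, whence
  independence of representatives.\<close>

lemma filter_comp_rep_restrict_right:
  assumes "X \<in> Obj K" "Y \<in> Obj K" "Z \<in> Obj K" "U \<in> Obj K" "U' \<in> Obj K" "V \<in> Obj K"
    "h \<in> hom 0 U' U" "f \<in> hom n (prd P X U) Y" "g \<in> hom n (prd P Y V) Z"
  shows "filter_comp_rep K P n X Y Z U' V g (filter_diag_mor K P X Y U U' h n f) =
    filter_diag_mor K P X Z (prd P U V) (prd P U' V) (prod_spx K P 0 U' U V V h (Ident K V)) n
      (filter_comp_rep K P n X Y Z U V g f)"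
  using assms
  by (simp add: filter_comp_rep_eq filter_diag_mor_eq prod_spx_def Let_def product_calculus)

lemma filter_comp_rep_restrict_left:
  assumes "X \<in> Obj K" "Y \<in> Obj K" "Z \<in> Obj K" "U \<in> Obj K" "V \<in> Obj K" "V' \<in> Obj K"
    "h \<in> hom 0 V' V" "f \<in> hom n (prd P X U) Y" "g \<in> hom n (prd P Y V) Z"
  shows "filter_comp_rep K P n X Y Z U V' (filter_diag_mor K P Y Z V V' h n g) f =
    filter_diag_mor K P X Z (prd P U V) (prd P U V') (prod_spx K P 0 U U V' V (Ident K U) h) n
      (filter_comp_rep K P n X Y Z U V g f)"
  using assms
  by (simp add: filter_comp_rep_eq filter_diag_mor_eq prod_spx_def Let_def product_calculus)

lemma filter_comp_rep_Ident_right: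
  assumes "X \<in> Obj K" "Y \<in> Obj K" "U \<in> Obj K" "f \<in> hom n (prd P X U) Y"
  shows "filter_comp_rep K P n X X Y (one P) U f (proj1 n X (one P)) =
    filter_diag_mor K P X Y U (prd P (one P) U) (pr2 P (one P) U) n f"
  using assms by (simp add: filter_comp_rep_eq filter_diag_mor_eq Let_def product_calculus)

lemma filter_comp_rep_Ident_left:
  assumes "X \<in> Obj K" "Y \<in> Obj K" "U \<in> Obj K" "f \<in> hom n (prd P X U) Y"
  shows "filter_comp_rep K P n X Y Y U (one P) (proj1 n Y (one P)) f =
    filter_diag_mor K P X Y U (prd P U (one P)) (pr1 P U (one P)) n f"
  using assms by (simp add: filter_comp_rep_eq filter_diag_mor_eq Let_def product_calculus)

text \<open>Both sides are (w, (u, (v, t))) |-> h (g (f (w, u), v), t). The two bracketings live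
  over different index objects, related by the associator of U, V and T.\<close>

lemma filter_comp_rep_assoc:
  assumes "W \<in> Obj K" "X \<in> Obj K" "Y \<in> Obj K" "Z \<in> Obj K" "U \<in> Obj K" "V \<in> Obj K" "T \<in> Obj K"
    "f \<in> hom n (prd P W U) X" "g \<in> hom n (prd P X V) Y" "h \<in> hom n (prd P Y T) Z"
  shows "filter_comp_rep K P n W X Z U (prd P V T) (filter_comp_rep K P n X Y Z V T h g) f =
    filter_diag_mor K P W Z (prd P (prd P U V) T) (prd P U (prd P V T)) (prod_assoc K P U V T) n
      (filter_comp_rep K P n W Y Z (prd P U V) T h (filter_comp_rep K P n W X Y U V g f))"
  using assms
  by (simp add: filter_comp_rep_eq filter_diag_mor_eq prod_assoc_def Let_def product_calculus)

end

section \<open>The filter quotient\<close>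

lemma mono_iso_refl:
  assumes "category C" "X \<in> cOb C" "p \<in> monos_into C X"
  shows "(p, p) \<in> mono_iso C X"
proof -
  obtain U m where p: "p = (U, m)" "U \<in> cOb C" "m \<in> cHom C U X"
    using assms(3) by (auto simp: monos_into_def is_mono_def)
  have 1: "cId C U \<in> cHom C U U" "cComp C U U U (cId C U) (cId C U) = cId C U"
    "cComp C U U X m (cId C U) = m"
    using assms(1,2) p unfolding category_def by simp_all
  then have "is_iso C U U (cId C U)" unfolding is_iso_def by blast
  then show ?thesis using assms(3) p(1) 1(3) unfolding mono_iso_def by auto
qed

lemma Sub_subset_monos_into: "S \<in> Sub C X \<Longrightarrow> S \<subseteq> monos_into C X"
  unfolding Sub_def by (auto elim!: quotientE simp: mono_iso_def)

text \<open>As an image under a relation, \<open>sub_class\<close> is empty when m is not a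
  monomorphism. Being a member of \<open>Sub\<close> rules this out, so from membership of a class
  in the filter one recovers that its named representative is a monomorphism, in particular for U x
  V -> 1.\<close>

lemma sub_class_self:
  assumes "category C" "X \<in> cOb C" "sub_class C X U m \<in> Sub C X"
  shows "(U, m) \<in> sub_class C X U m"
proof -
  obtain p where p: "p \<in> monos_into C X" "sub_class C X U m = mono_iso C X `` {p}"
    using assms(3) unfolding Sub_def by (elim quotientE)
  then have "p \<in> sub_class C X U m" using mono_iso_refl[OF assms(1,2)] by blast
  then have "(U, m) \<in> monos_into C X" by (auto simp: sub_class_def mono_iso_def)
  then show ?thesis using mono_iso_refl[OF assms(1,2)] by (auto simp: sub_class_def)
qed

locale simplicial_filter = simplicial_products K P
  for K :: "('o, 'a) scat" and P :: "('o, 'a) fin_products" +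
  fixes \<Phi> :: "('o \<times> 'a) set set"
  assumes filter: "product_closed_filter K P \<Phi>"
begin

abbreviation \<Phi>_ob :: "'o set" where
  "\<Phi>_ob \<equiv> cOb (filter_cat K \<Phi>)"

abbreviation \<Phi>_op :: "('o, 'a) cat" where
  "\<Phi>_op \<equiv> op_cat (filter_cat K \<Phi>)"

section \<open>The index category of the filter\<close>

lemma category_underlying: "category (underlying_cat K)"
proof -
  have "Comp K 0 X X Y f (Ident K X) = f \<and> Comp K 0 X Y Y (Ident K Y) f = f"
    if "X \<in> Obj K" "Y \<in> Obj K" "f \<in> hom 0 X Y" for X Y f
    using that Comp_Ident_left[of X Y f 0] Comp_Ident_right[of X Y f 0] by (simp add: const_0 Ident_in)
  then show ?thesis
    unfolding category_def underlying_cat_def by (simp add: Ident_in Comp_in Comp_assoc)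
qed

lemma \<Phi>_op_simps:
  "cOb \<Phi>_op = \<Phi>_ob" "cHom \<Phi>_op U V = hom 0 V U" "cId \<Phi>_op = Ident K"
  "cComp \<Phi>_op U V W g f = Comp K 0 W V U f g"
  by (simp_all add: op_cat_def filter_cat_def full_subcat_def underlying_cat_def)

lemma \<Phi>_ob_iff: "U \<in> \<Phi>_ob \<longleftrightarrow> U \<in> Obj K \<and> (\<exists>S\<in>\<Phi>. \<exists>m. (U, m) \<in> S)"
  by (force simp: filter_cat_def full_subcat_def underlying_cat_def)

lemma \<Phi>_ob_Obj: "U \<in> \<Phi>_ob \<Longrightarrow> U \<in> Obj K"
  by (simp add: \<Phi>_ob_iff)

lemma \<Phi>_subset_Sub: "\<Phi> \<subseteq> Sub (underlying_cat K) (one P)"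
  using filter by (simp add: product_closed_filter_def Let_def)

lemma sub_class_\<Phi>_ob:
  assumes "sub_class (underlying_cat K) (one P) U m \<in> \<Phi>"
  shows "U \<in> \<Phi>_ob"
proof -
  have "one P \<in> cOb (underlying_cat K)" by (simp add: underlying_cat_def one_in)
  then have "(U, m) \<in> sub_class (underlying_cat K) (one P) U m"
    using assms \<Phi>_subset_Sub by (intro sub_class_self category_underlying) auto
  moreover from this have "U \<in> Obj K"
    using assms \<Phi>_subset_Sub Sub_subset_monos_into
    by (fastforce simp: monos_into_def underlying_cat_def)
  ultimately show ?thesis using assms unfolding \<Phi>_ob_iff by blast
qed

lemma one_\<Phi>_ob: "one P \<in> \<Phi>_ob"
  using filter by (intro sub_class_\<Phi>_ob[of _ "Ident K (one P)"]) (simp add: product_closed_filter_def Let_def)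

lemma prd_\<Phi>_ob:
  assumes "U \<in> \<Phi>_ob" "V \<in> \<Phi>_ob"
  shows "prd P U V \<in> \<Phi>_ob"
proof -
  obtain S m T n where ST: "S \<in> \<Phi>" "(U, m) \<in> S" "T \<in> \<Phi>" "(V, n) \<in> T"
    using assms unfolding \<Phi>_ob_iff by blast
  have *: "\<forall>S\<in>\<Phi>. \<forall>T\<in>\<Phi>. \<forall>(U, m)\<in>S. \<forall>(V, n)\<in>T. sub_class (underlying_cat K) (one P) (prd P U V)
      (cComp (underlying_cat K) (prd P U V) U (one P) m (pr1 P U V)) \<in> \<Phi>"
    using filter by (simp add: product_closed_filter_def Let_def underlying_cat_def)
  have "sub_class (underlying_cat K) (one P) (prd P U V)
      (cComp (underlying_cat K) (prd P U V) U (one P) m (pr1 P U V)) \<in> \<Phi>"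
    using bspec[OF bspec[OF bspec[OF * ST(1)] ST(3)] ST(2)] ST(4) by auto
  then show ?thesis by (rule sub_class_\<Phi>_ob)
qed

text \<open>Parallel arrows into U agree after U -> 1 because 1 is terminal, and U -> 1 is a
  monomorphism.\<close>

lemma \<Phi>_arrow_unique:
  assumes "U \<in> \<Phi>_ob" "V \<in> Obj K" "h \<in> hom 0 V U" "h' \<in> hom 0 V U"
  shows "h = h'"
proof -
  obtain S m where "S \<in> \<Phi>" "(U, m) \<in> S" and U: "U \<in> Obj K" using assms(1) unfolding \<Phi>_ob_iff by blast
  then have "(U, m) \<in> monos_into (underlying_cat K) (one P)"
    by (meson Sub_subset_monos_into[OF subsetD[OF \<Phi>_subset_Sub]] subsetD)
  then have m: "m \<in> hom 0 U (one P)"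
    and mono: "Comp K 0 V U (one P) m h = Comp K 0 V U (one P) m h' \<Longrightarrow> h = h'"
    using assms by (auto simp: monos_into_def is_mono_def underlying_cat_def)
  have "\<exists>!t. t \<in> hom 0 V (one P)"
    using fin_products assms(2) by (simp add: are_fin_products_def is_sterminal_def)
  moreover have "Comp K 0 V U (one P) m h \<in> hom 0 V (one P)" "Comp K 0 V U (one P) m h' \<in> hom 0 V (one P)"
    using assms U m by (simp_all add: Comp_in one_in)
  ultimately show ?thesis using mono by blast
qed

text \<open>Products with their projections are the upper bounds in the opposite category. Parallel
  arrows are already equal, so an identity coequalizes them.\<close>

lemma filtered_\<Phi>_op: "filtered_category \<Phi>_op"
proof -
  have "Comp K 0 X X Y f (Ident K X) = f \<and> Comp K 0 X Y Y (Ident K Y) f = f"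
    if "X \<in> Obj K" "Y \<in> Obj K" "f \<in> hom 0 X Y" for X Y f
    using that category_underlying unfolding category_def by (simp add: underlying_cat_def)
  then have "category \<Phi>_op"
    unfolding category_def by (simp add: \<Phi>_op_simps \<Phi>_ob_Obj Ident_in Comp_in Comp_assoc)
  moreover have "\<exists>W\<in>\<Phi>_ob. hom 0 W U \<noteq> {} \<and> hom 0 W V \<noteq> {}" if "U \<in> \<Phi>_ob" "V \<in> \<Phi>_ob" for U V
    using that prd_\<Phi>_ob pr1_in[of U V] pr2_in[of U V] \<Phi>_ob_Obj by blast
  moreover have "\<exists>W\<in>\<Phi>_ob. \<exists>h\<in>hom 0 W V. Comp K 0 W V U f h = Comp K 0 W V U g h"
    if "U \<in> \<Phi>_ob" "V \<in> \<Phi>_ob" "f \<in> hom 0 V U" "g \<in> hom 0 V U" for U V f g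
    using that \<Phi>_arrow_unique \<Phi>_ob_Obj Ident_in by blast
  ultimately show ?thesis
    unfolding filtered_category_def using one_\<Phi>_ob by (auto simp: \<Phi>_op_simps)
qed

lemma filter_diagram:
  assumes "X \<in> Obj K" "Y \<in> Obj K"
  shows "filtered_sset_diagram \<Phi>_op (filter_diag_ob K P X Y) (filter_diag_mor K P X Y)"
proof (unfold_locales, goal_cases)
  case 1
  then show ?case by (rule filtered_\<Phi>_op)
next
  case (2 U)
  then show ?case using assms by (simp add: \<Phi>_op_simps filter_diag_ob_def sset_Map prd_in \<Phi>_ob_Obj)
next
  case (3 U V h)
  then show ?case
    unfolding simplicial_map_def using assms
    by (simp add: \<Phi>_op_simps filter_diag_ob_def \<Phi>_ob_Obj filter_diag_mor_in act_filter_diag_mor)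
next
  case (4 U f n)
  then show ?case using assms
    by (simp add: \<Phi>_op_simps filter_diag_ob_def \<Phi>_ob_Obj filter_diag_mor_Ident)
next
  case (5 U V W h h' f n)
  then show ?case using assms
    by (simp add: \<Phi>_op_simps filter_diag_ob_def \<Phi>_ob_Obj filter_diag_mor_Comp)
qed

section \<open>Classes and composition in the filter quotient\<close>

abbreviation quot :: "('o, ('o \<times> 'a) set) scat" where
  "quot \<equiv> filter_quotient K P \<Phi>"

text \<open>The diagram changes with X and Y, and one composition involves three of them, so classes
  carry X and Y as arguments.\<close>

definition cls :: "nat \<Rightarrow> 'o \<Rightarrow> 'o \<Rightarrow> 'o \<Rightarrow> 'a \<Rightarrow> ('o \<times> 'a) set" where
  "cls n X Y U f = filter_rel K P \<Phi> n X Y `` {(U, f)}"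

lemma cls_eq_colim_cls:
  "X \<in> Obj K \<Longrightarrow> Y \<in> Obj K \<Longrightarrow> cls n X Y U f =
    filtered_sset_diagram.cls \<Phi>_op (filter_diag_ob K P X Y) (filter_diag_mor K P X Y) n U f"
  by (simp add: cls_def filter_rel_def filtered_sset_diagram.cls_def[OF filter_diagram])

lemma Map_quot:
  "Map quot X Y = sset_colim \<Phi>_op (filter_diag_ob K P X Y) (filter_diag_mor K P X Y)"
  by (simp add: filter_quotient_def)

lemma Obj_quot: "Obj quot = Obj K"
  by (simp add: filter_quotient_def)

lemma cls_in:
  "X \<in> Obj K \<Longrightarrow> Y \<in> Obj K \<Longrightarrow> U \<in> \<Phi>_ob \<Longrightarrow> f \<in> hom n (prd P X U) Y \<Longrightarrow>
    cls n X Y U f \<in> Spx (Map quot X Y) n"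
  by (simp add: cls_eq_colim_cls Map_quot filtered_sset_diagram.cls_in[OF filter_diagram]
      \<Phi>_op_simps filter_diag_ob_def)

lemma quot_cases:
  assumes "X \<in> Obj K" "Y \<in> Obj K" "c \<in> Spx (Map quot X Y) n"
  obtains U f where "U \<in> \<Phi>_ob" "f \<in> hom n (prd P X U) Y" "c = cls n X Y U f"
proof -
  obtain U f where "U \<in> cOb \<Phi>_op" "f \<in> Spx (filter_diag_ob K P X Y U) n" "c = cls n X Y U f"
    using filtered_sset_diagram.colim_cases[OF filter_diagram[OF assms(1,2)], of c n] assms
    by (auto simp: Map_quot cls_eq_colim_cls)
  then show ?thesis using that by (simp add: \<Phi>_op_simps filter_diag_ob_def)
qed

lemma act_cls:
  "X \<in> Obj K \<Longrightarrow> Y \<in> Obj K \<Longrightarrow> U \<in> \<Phi>_ob \<Longrightarrow> f \<in> hom n (prd P X U) Y \<Longrightarrow> \<alpha> \<in> simplex_arr m n \<Longrightarrow>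
    act (Map quot X Y) m n \<alpha> (cls n X Y U f) = cls m X Y U (act (Map K (prd P X U) Y) m n \<alpha> f)"
  by (simp add: cls_eq_colim_cls Map_quot filtered_sset_diagram.act_cls[OF filter_diagram]
      \<Phi>_op_simps filter_diag_ob_def)

lemma cls_restrict:
  assumes "X \<in> Obj K" "Y \<in> Obj K" "U \<in> \<Phi>_ob" "V \<in> \<Phi>_ob" "h \<in> hom 0 V U" "f \<in> hom n (prd P X U) Y"
  shows "cls n X Y V (filter_diag_mor K P X Y U V h n f) = cls n X Y U f"
  using filtered_sset_diagram.cls_Fm[OF filter_diagram[OF assms(1,2)], of U V h f n] assms
  by (simp add: cls_eq_colim_cls \<Phi>_op_simps filter_diag_ob_def)

lemma cls_self: "(U, f) \<in> cls n X Y U f"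
  unfolding cls_def filter_rel_def colim_rel_def by simp

lemma cls_memE:
  assumes "X \<in> Obj K" "Y \<in> Obj K" "U \<in> \<Phi>_ob" "f \<in> hom n (prd P X U) Y" "(V, g) \<in> cls n X Y U f"
  obtains W h h' where "V \<in> \<Phi>_ob" "g \<in> hom n (prd P X V) Y" "W \<in> \<Phi>_ob" "h \<in> hom 0 W U"
    "h' \<in> hom 0 W V" "filter_diag_mor K P X Y U W h n f = filter_diag_mor K P X Y V W h' n g"
proof -
  note D = filter_diagram[OF assms(1,2)]
  have "((U, f), (V, g)) \<in> colim_rel \<Phi>_op (filter_diag_ob K P X Y) (filter_diag_mor K P X Y) n"
    using assms(5) by (simp add: cls_def filter_rel_def)
  then have "filtered_sset_diagram.meets \<Phi>_op (filter_diag_ob K P X Y) (filter_diag_mor K P X Y) n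
      (U, f) (V, g)"
    using filtered_sset_diagram.rel_iff_meets[OF D, of U f n] assms(3,4)
    by (simp add: \<Phi>_op_simps filter_diag_ob_def)
  then show ?thesis
    by (rule filtered_sset_diagram.meetsE[OF D])
      (use that in \<open>simp add: \<Phi>_op_simps filter_diag_ob_def\<close>)
qed

text \<open>A change of representative is a restriction to a common stage followed by the inverse of
  another one, and composition respects restriction in each factor separately.\<close>

lemma cls_comp_rep_cong:
  assumes XYZ: "X \<in> Obj K" "Y \<in> Obj K" "Z \<in> Obj K"
    and U: "U \<in> \<Phi>_ob" "f \<in> hom n (prd P X U) Y" and V: "V \<in> \<Phi>_ob" "g \<in> hom n (prd P Y V) Z"
    and U': "(U', f') \<in> cls n X Y U f" and V': "(V', g') \<in> cls n Y Z V g"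
  shows "cls n X Z (prd P U' V') (filter_comp_rep K P n X Y Z U' V' g' f') =
    cls n X Z (prd P U V) (filter_comp_rep K P n X Y Z U V g f)"
proof -
  have right: "cls n X Z (prd P A T) (filter_comp_rep K P n X Y Z A T k a) =
      cls n X Z (prd P B T) (filter_comp_rep K P n X Y Z B T k (filter_diag_mor K P X Y A B h n a))"
    if "A \<in> \<Phi>_ob" "B \<in> \<Phi>_ob" "T \<in> \<Phi>_ob" "h \<in> hom 0 B A" "a \<in> hom n (prd P X A) Y"
      "k \<in> hom n (prd P Y T) Z" for A B T h a k
    using that XYZ \<Phi>_ob_Obj
    by (simp add: filter_comp_rep_restrict_right cls_restrict prd_\<Phi>_ob prod_spx_in Ident_in
        filter_comp_rep_in)
  have left: "cls n X Z (prd P T A) (filter_comp_rep K P n X Y Z T A a k) =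
      cls n X Z (prd P T B) (filter_comp_rep K P n X Y Z T B (filter_diag_mor K P Y Z A B h n a) k)"
    if "A \<in> \<Phi>_ob" "B \<in> \<Phi>_ob" "T \<in> \<Phi>_ob" "h \<in> hom 0 B A" "a \<in> hom n (prd P Y A) Z"
      "k \<in> hom n (prd P X T) Y" for A B T h a k
    using that XYZ \<Phi>_ob_Obj
    by (simp add: filter_comp_rep_restrict_left cls_restrict prd_\<Phi>_ob prod_spx_in Ident_in
        filter_comp_rep_in)
  obtain W h h' where W: "U' \<in> \<Phi>_ob" "f' \<in> hom n (prd P X U') Y" "W \<in> \<Phi>_ob" "h \<in> hom 0 W U"
    "h' \<in> hom 0 W U'" "filter_diag_mor K P X Y U W h n f = filter_diag_mor K P X Y U' W h' n f'"
    using cls_memE[OF XYZ(1,2) U U'] by blast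
  obtain W' e e' where W': "V' \<in> \<Phi>_ob" "g' \<in> hom n (prd P Y V') Z" "W' \<in> \<Phi>_ob" "e \<in> hom 0 W' V"
    "e' \<in> hom 0 W' V'" "filter_diag_mor K P Y Z V W' e n g = filter_diag_mor K P Y Z V' W' e' n g'"
    using cls_memE[OF XYZ(2,3) V V'] by blast
  \<comment> \<open>The index objects run from U' x V' through W x V', U x V' and U x W' to U x V:
    first f' is exchanged for f with g' fixed, then g' for g with f fixed.\<close>
  show ?thesis
    using right[OF W(1,3) W'(1) W(5,2) W'(2)] right[OF U(1) W(3) W'(1) W(4) U(2) W'(2)]
      left[OF W'(1,3) U(1) W'(5,2) U(2)] left[OF V(1) W'(3) U(1) W'(4) V(2) U(2)] W(6) W'(6)
    by simp
qed

text \<open>The union defining \<open>Comp\<close> runs over a nonempty family of equal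
  classes.\<close>

lemma Comp_cls:
  assumes "X \<in> Obj K" "Y \<in> Obj K" "Z \<in> Obj K"
    "U \<in> \<Phi>_ob" "f \<in> hom n (prd P X U) Y" "V \<in> \<Phi>_ob" "g \<in> hom n (prd P Y V) Z"
  shows "Comp quot n X Y Z (cls n Y Z V g) (cls n X Y U f) =
    cls n X Z (prd P U V) (filter_comp_rep K P n X Y Z U V g f)"
proof -
  let ?S = "{(prd P U' V', filter_comp_rep K P n X Y Z U' V' g' f') | U' V' f' g'.
    (U', f') \<in> cls n X Y U f \<and> (V', g') \<in> cls n Y Z V g}"
  have "Comp quot n X Y Z (cls n Y Z V g) (cls n X Y U f) =
      (\<Union>p\<in>?S. filter_rel K P \<Phi> n X Z `` {p})"
    unfolding filter_quotient_def scat.simps by (rule Image_eq_UN)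
  also have "\<dots> = cls n X Z (prd P U V) (filter_comp_rep K P n X Y Z U V g f)"
  proof (rule SUP_eq_const)
    show "?S \<noteq> {}" using cls_self by blast
    fix p assume "p \<in> ?S"
    then show "filter_rel K P \<Phi> n X Z `` {p} =
        cls n X Z (prd P U V) (filter_comp_rep K P n X Y Z U V g f)"
      using cls_comp_rep_cong[OF assms] unfolding cls_def[of n X Z] by force
  qed
  finally show ?thesis .
qed

section \<open>The axioms of an enriched category\<close>

lemma Ident_quot: "Ident quot X = cls 0 X X (one P) (pr1 P X (one P))"
  by (simp add: filter_quotient_def cls_def)

lemma Ident_quot_in: "X \<in> Obj K \<Longrightarrow> Ident quot X \<in> Spx (Map quot X X) 0"
  by (simp add: Ident_quot cls_in one_\<Phi>_ob pr1_in one_in)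

lemma const_Ident_quot:
  assumes "X \<in> Obj K"
  shows "const_spx quot n X X (Ident quot X) = cls n X X (one P) (proj1 n X (one P))"
  using act_cls[OF assms assms one_\<Phi>_ob pr1_in[OF assms one_in] simplex_arr_zero]
  by (simp only: const_spx_def Ident_quot)

lemma simplicial_category_quot: "simplicial_category quot"
  unfolding simplicial_category_def Obj_quot
proof (intro conjI ballI allI)
  fix X Y assume "X \<in> Obj K" "Y \<in> Obj K"
  then show "simplicial_set (Map quot X Y)"
    unfolding Map_quot by (intro filtered_sset_diagram.simplicial_set_colim filter_diagram)
next
  fix X Y Z assume XYZ: "X \<in> Obj K" "Y \<in> Obj K" "Z \<in> Obj K"
  have "Comp quot n X Y Z g f \<in> Spx (Map quot X Z) n"
    if "g \<in> Spx (Map quot Y Z) n" "f \<in> Spx (Map quot X Y) n" for n f g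
    using that XYZ \<Phi>_ob_Obj
    by (elim quot_cases[rotated 2])
      (simp_all add: Comp_cls cls_in prd_\<Phi>_ob filter_comp_rep_in)
  moreover have "Comp quot m X Y Z (act (Map quot Y Z) m n \<alpha> g) (act (Map quot X Y) m n \<alpha> f) =
      act (Map quot X Z) m n \<alpha> (Comp quot n X Y Z g f)"
    if "g \<in> Spx (Map quot Y Z) n" "f \<in> Spx (Map quot X Y) n" "\<alpha> \<in> simplex_arr m n" for m n f g \<alpha>
    using that XYZ \<Phi>_ob_Obj
    by (elim quot_cases[rotated 2])
      (simp_all add: Comp_cls act_cls prd_\<Phi>_ob prd_in act_in filter_comp_rep_in act_filter_comp_rep)
  ultimately show "simplicial_map (sset_prod (Map quot Y Z) (Map quot X Y)) (Map quot X Z)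
      (\<lambda>n (g, f). Comp quot n X Y Z g f)"
    unfolding simplicial_map_def sset_prod_def by auto
next
  fix X assume "X \<in> Obj K"
  then show "Ident quot X \<in> Spx (Map quot X X) 0" by (rule Ident_quot_in)
next
  fix X Y n c assume XY: "X \<in> Obj K" "Y \<in> Obj K" and c: "c \<in> Spx (Map quot X Y) n"
  obtain U f where U: "U \<in> \<Phi>_ob" "f \<in> hom n (prd P X U) Y" "c = cls n X Y U f"
    using quot_cases[OF XY c] .
  then show "Comp quot n X X Y c (const_spx quot n X X (Ident quot X)) = c"
    using XY by (simp add: const_Ident_quot Comp_cls one_\<Phi>_ob \<Phi>_ob_Obj const_in pr1_in one_in prd_in
        filter_comp_rep_Ident_right cls_restrict prd_\<Phi>_ob pr2_in)
  show "Comp quot n X Y Y (const_spx quot n Y Y (Ident quot Y)) c = c"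
    using XY U by (simp add: const_Ident_quot Comp_cls one_\<Phi>_ob \<Phi>_ob_Obj const_in pr1_in one_in prd_in
        filter_comp_rep_Ident_left cls_restrict prd_\<Phi>_ob)
next
  fix W X Y Z n a b c
  assume ob: "W \<in> Obj K" "X \<in> Obj K" "Y \<in> Obj K" "Z \<in> Obj K"
    and spx: "a \<in> Spx (Map quot W X) n" "b \<in> Spx (Map quot X Y) n" "c \<in> Spx (Map quot Y Z) n"
  obtain U f where U: "U \<in> \<Phi>_ob" "f \<in> hom n (prd P W U) X" "a = cls n W X U f"
    using quot_cases[OF ob(1,2) spx(1)] .
  obtain V g where V: "V \<in> \<Phi>_ob" "g \<in> hom n (prd P X V) Y" "b = cls n X Y V g"
    using quot_cases[OF ob(2,3) spx(2)] .
  obtain T h where T: "T \<in> \<Phi>_ob" "h \<in> hom n (prd P Y T) Z" "c = cls n Y Z T h"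
    using quot_cases[OF ob(3,4) spx(3)] .
  show "Comp quot n W X Z (Comp quot n X Y Z c b) a = Comp quot n W Y Z c (Comp quot n W X Y b a)"
    using ob U V T \<Phi>_ob_Obj
    by (simp add: Comp_cls prd_\<Phi>_ob prd_in filter_comp_rep_in filter_comp_rep_assoc cls_restrict
        prod_assoc_in)
qed

lemma kan_enriched_category_quot:
  assumes "\<And>X Y. X \<in> Obj K \<Longrightarrow> Y \<in> Obj K \<Longrightarrow> kan_complex (Map K X Y)"
  shows "kan_enriched_category quot"
  unfolding kan_enriched_category_def Obj_quot
proof (intro conjI ballI simplicial_category_quot)
  fix X Y assume "X \<in> Obj K" "Y \<in> Obj K"
  then show "kan_complex (Map quot X Y)"
    unfolding Map_quot using assms
    by (intro filtered_sset_diagram.kan_complex_colim filter_diagram)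
      (simp_all add: \<Phi>_op_simps filter_diag_ob_def \<Phi>_ob_Obj prd_in)
qed

end

theorem proposition3p2:
  fixes K :: "('o, 'a) scat"
    and P :: "('o, 'a) fin_products"
    and \<Phi> :: "('o \<times> 'a) set set"
  assumes "kan_enriched_category K"
    and "finitely_complete K"
    and "are_fin_products K P"
    and "product_closed_filter K P \<Phi>"
  shows "kan_enriched_category (filter_quotient K P \<Phi>)"
proof -
  interpret simplicial_filter K P \<Phi>
    using assms by unfold_locales (simp_all add: kan_enriched_category_def)
  show ?thesis
    using assms(1) by (intro kan_enriched_category_quot) (simp add: kan_enriched_category_def)
qed

end
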